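(* Let $\alpha,\beta$ be two Mulholland functions. If $\alpha(x)\ll\beta(x)$ as $x\to\infty$ (i.e. $\lim_{x\to\infty}\alpha(x)/\beta(x)=0$), then, both over $\mathcal{R}$ and over $\mathcal{D}$, the topology $\mathbb{T}_{W^\beta}$ generated by the Wasserstein metric $W^\beta$ is strictly finer than the topology $\mathbb{T}_{W^\alpha}$ generated by $W^\alpha$.
   Context: Fix $n\ge 2$; $\mathbb{E}^n$ is $n$-dimensional Euclidean space with distance $d$; $v$ is $n$-dimensional volume. A region is a nonempty bounded open subset of $\mathbb{E}^n$ equal to the interior of its closure; $\mathcal{R}$ is the set of all regions. $\mathcal{C}$ is the set of convex regions; for regions $X,Y$, $d(X,Y)=\min_{x\in\bar X,y\in\bar Y}d(x,y)$; $\mathcal{D}^2=\{X\cup Y: X,Y\in\mathcal{C},\ d(X,Y)>0\}$; $\mathcal{D}=\mathcal{C}\cup\mathcal{D}^2$. Mulholland function: a continuous, (strictly) increasing $\psi:\mathbb{R}^{\ge0}\to\mathbb{R}^{\ge0}$ with $\psi(0)=0$, $\lim_{x\to\infty}\psi(x)=\infty$, and $\psi^{-1}(\sum_{i=1}^m\psi(x_i+y_i))\le\psi^{-1}(\sum_{i=1}^m\psi(x_i))+\psi^{-1}(\sum_{i=1}^m\psi(y_i))$ for all $m$ and all $x_i,y_i\ge0$. Wasserstein metric: for a region $P$ let $U_P$ be the uniform probability distribution on $P$. For regions $P,Q$, $W^\psi(P,Q)=\inf_\gamma\psi^{-1}\left(\frac{1}{v(P)}\int_P\psi(d(x,\gamma(x)))\,dx\right)$,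 the infimum over all (measurable) functions $\gamma$ such that if a random variable $X$ has distribution $U_P$ then $\gamma(X)$ has distribution $U_Q$. *)

theory Defs
  imports "HOL-Analysis.Analysis"
begin

definition regions :: "'a::euclidean_space set set" where
  "regions = {P. P \<noteq> {} \<and> bounded P \<and> open P \<and> interior (closure P) = P}"

definition convex_regions :: "'a::euclidean_space set set" where
  "convex_regions = {P \<in> regions. convex P}"

text \<open>
  Closures of regions are nonempty and compact, so the infimum in \<^const>\<open>setdist\<close> is
  attained: it is the minimum distance between points of the closures.
\<close>

definition separated_convex_pairs :: "'a::euclidean_space set set" where
  "separated_convex_pairs =
     {X \<union> Y | X Y. X \<in> convex_regions \<and> Y \<in> convex_regions \<and>
                  setdist (closure X) (closure Y) > 0}"

definition convex_or_pair_regions :: "'a::euclidean_space set set" where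
  "convex_or_pair_regions = convex_regions \<union> separated_convex_pairs"

text \<open>
  Functions on the nonnegative reals are represented by functions on the reals, of which
  only the values on \<^term>\<open>{0::real..}\<close> are constrained and used.
\<close>

definition nonneg_inv :: "(real \<Rightarrow> real) \<Rightarrow> real \<Rightarrow> real" where
  "nonneg_inv \<psi> = the_inv_into {0..} \<psi>"

definition mulholland :: "(real \<Rightarrow> real) \<Rightarrow> bool" where
  "mulholland \<psi> \<longleftrightarrow>
     \<psi> \<in> {0..} \<rightarrow> {0..} \<and>
     continuous_on {0..} \<psi> \<and>
     strict_mono_on {0..} \<psi> \<and>
     \<psi> 0 = 0 \<and>
     filterlim \<psi> at_top at_top \<and>
     (\<forall>(m::nat) (x::nat \<Rightarrow> real) (y::nat \<Rightarrow> real).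
        (\<forall>i\<in>{1..m}. 0 \<le> x i \<and> 0 \<le> y i) \<longrightarrow>
        nonneg_inv \<psi> (\<Sum>i=1..m. \<psi> (x i + y i))
          \<le> nonneg_inv \<psi> (\<Sum>i=1..m. \<psi> (x i)) + nonneg_inv \<psi> (\<Sum>i=1..m. \<psi> (y i)))"

text \<open>
  For a random variable with law \<^term>\<open>uniform_measure lborel P\<close>, its image under
  \<open>\<gamma>\<close> has law \<^term>\<open>distr (uniform_measure lborel P) borel \<gamma>\<close>.
\<close>

definition transport_maps ::
    "'a::euclidean_space set \<Rightarrow> 'a set \<Rightarrow> ('a \<Rightarrow> 'a) set" where
  "transport_maps P Q =
     {\<gamma> \<in> borel_measurable borel.
        distr (uniform_measure lborel P) borel \<gamma> = uniform_measure lborel Q}"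

definition wasserstein ::
    "(real \<Rightarrow> real) \<Rightarrow> 'a::euclidean_space set \<Rightarrow> 'a set \<Rightarrow> real" where
  "wasserstein \<psi> P Q =
     (INF \<gamma>\<in>transport_maps P Q.
        nonneg_inv \<psi> (1 / measure lborel P * (LINT x:P|lborel. \<psi> (dist x (\<gamma> x)))))"

text \<open>
  The open sets of \<^const>\<open>Metric_space.mtopology\<close>, written out so that the definition
  can be unfolded without first establishing the metric axioms for \<open>d\<close>.
\<close>

definition metric_topology :: "'b set \<Rightarrow> ('b \<Rightarrow> 'b \<Rightarrow> real) \<Rightarrow> 'b topology" where
  "metric_topology M d =
     topology (\<lambda>U. U \<subseteq> M \<and> (\<forall>P\<in>U. \<exists>r>0. {Q \<in> M. d P Q < r} \<subseteq> U))"

lemma openin_metric_topology: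
  "openin (metric_topology M d) U \<longleftrightarrow>
     U \<subseteq> M \<and> (\<forall>P\<in>U. \<exists>r>0. {Q \<in> M. d P Q < r} \<subseteq> U)"
proof -
  have "istopology (\<lambda>U. U \<subseteq> M \<and> (\<forall>P\<in>U. \<exists>r>0. {Q \<in> M. d P Q < r} \<subseteq> U))"
    unfolding istopology_def
  proof (intro conjI allI impI)
    fix S T
    assume S: "S \<subseteq> M \<and> (\<forall>P\<in>S. \<exists>r>0. {Q \<in> M. d P Q < r} \<subseteq> S)"
      and T: "T \<subseteq> M \<and> (\<forall>P\<in>T. \<exists>r>0. {Q \<in> M. d P Q < r} \<subseteq> T)"
    show "S \<inter> T \<subseteq> M" using S by blast
    show "\<forall>P\<in>S \<inter> T. \<exists>r>0. {Q \<in> M. d P Q < r} \<subseteq> S \<inter> T"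
    proof
      fix P assume "P \<in> S \<inter> T"
      then obtain r s where "r > 0" "s > 0"
        "{Q \<in> M. d P Q < r} \<subseteq> S" "{Q \<in> M. d P Q < s} \<subseteq> T"
        using S T by blast
      then show "\<exists>r>0. {Q \<in> M. d P Q < r} \<subseteq> S \<inter> T"
        by (intro exI[of _ "min r s"]) auto
    qed
  next
    fix K
    assume K: "\<forall>S\<in>K. S \<subseteq> M \<and> (\<forall>P\<in>S. \<exists>r>0. {Q \<in> M. d P Q < r} \<subseteq> S)"
    then show "\<Union>K \<subseteq> M" by blast
    show "\<forall>P\<in>\<Union>K. \<exists>r>0. {Q \<in> M. d P Q < r} \<subseteq> \<Union>K"
      using K by (meson UnionE Union_upper order_trans)
  qed
  then show ?thesis
    unfolding metric_topology_def by (simp add: topology_inverse')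
qed

lemma metric_topology_eq_mtopology:
  assumes "Metric_space M d"
  shows "metric_topology M d = Metric_space.mtopology M d"
proof (rule topology_eq[THEN iffD2], intro allI)
  interpret Metric_space M d by fact
  have ball: "mball P r = {Q \<in> M. d P Q < r}" if "P \<in> M" for P r
    using that by auto
  show "openin (metric_topology M d) U \<longleftrightarrow> openin mtopology U" for U
    unfolding openin_metric_topology openin_mtopology
    by (metis ball subset_iff)
qed

definition strictly_finer :: "'b topology \<Rightarrow> 'b topology \<Rightarrow> bool" where
  "strictly_finer T S \<longleftrightarrow> {U. openin S U} \<subset> {U. openin T U}"

end

theory Submission imports Defs "HOL-Probability.Probability_Measure" begin

text \<open>
  Since \<open>\<alpha> t \<le> \<alpha> \<delta> + C * \<beta> t\<close> for every \<open>\<delta> > 0\<close> and a suitable \<open>C\<close>, a small \<open>\<beta>\<close>-distance forces a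
  small \<open>\<alpha>\<close>-distance, so every \<open>\<alpha>\<close>-open set is \<open>\<beta>\<close>-open. For strictness, translate a slab of
  volume \<open>m\<close> of the unit cube by the distance \<open>R\<close>, orthogonally to its wide faces. The \<open>\<alpha>\<close>-distance to
  the cube is at most \<open>nonneg_inv \<alpha> (\<alpha> R * m)\<close>, the \<open>\<beta>\<close>-distance at least
  \<open>nonneg_inv \<beta> (\<beta> (R - m) * m)\<close>; along suitable \<open>m\<close> tending to 0 and \<open>R\<close> to infinity the
  former tends to 0 while the latter stays constant. The complement of such a sequence of
  regions is then \<open>\<beta>\<close>-open but not \<open>\<alpha>\<close>-open.

  Mulholland's inequality concerns sums, not averages, and averages need not satisfy it (for
  \<open>\<psi> x = exp x - 1\<close> they do not), so the triangle inequality is not available here and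
  the argument avoids it: the complement is seen to be \<open>\<beta>\<close>-open by bounding the
  \<open>\<beta>\<close>-distances from each of its points to the sequence from below. As the infimum of the
  empty set is unspecified, this needs a transport map between any two regions.
\<close>

section \<open>Mulholland functions and transport costs\<close>

lemma mulholland_ivt:
  assumes "mulholland \<psi>" "0 \<le> u"
  shows "\<exists>x\<ge>0. \<psi> x = u"
proof -
  have "eventually (\<lambda>x. u \<le> \<psi> x) at_top"
    using assms unfolding mulholland_def filterlim_at_top by blast
  then obtain N where N: "\<And>x. x \<ge> N \<Longrightarrow> u \<le> \<psi> x"
    by (auto simp: eventually_at_top_linorder)
  have "\<exists>x\<ge>0. x \<le> max 0 N \<and> \<psi> x = u"
    using assms N by (intro IVT') (auto simp: mulholland_def elim: continuous_on_subset)
  then show ?thesis by blast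
qed

lemma mulholland_nonneg_inv:
  assumes "mulholland \<psi>" "0 \<le> u"
  shows "0 \<le> nonneg_inv \<psi> u" "\<psi> (nonneg_inv \<psi> u) = u"
proof -
  have inj: "inj_on \<psi> {0..}"
    using assms strict_mono_on_imp_inj_on by (auto simp: mulholland_def)
  have "u \<in> \<psi> ` {0..}"
    using mulholland_ivt[OF assms] by force
  with inj show "0 \<le> nonneg_inv \<psi> u" "\<psi> (nonneg_inv \<psi> u) = u"
    unfolding nonneg_inv_def using the_inv_into_into[OF inj, of u "{0..}"] f_the_inv_into_f[OF inj]
    by auto
qed

lemma mulholland_less_iff:
  assumes "mulholland \<psi>" "0 \<le> x" "0 \<le> y"
  shows "\<psi> x < \<psi> y \<longleftrightarrow> x < y"
proof -
  have "strict_mono_on {0..} \<psi>" using assms(1) by (simp only: mulholland_def)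
  from strict_mono_on_less[OF this] show ?thesis using assms by simp
qed

lemma mulholland_le_iff:
  assumes "mulholland \<psi>" "0 \<le> x" "0 \<le> y"
  shows "\<psi> x \<le> \<psi> y \<longleftrightarrow> x \<le> y"
  using mulholland_less_iff[OF assms(1,3,2)] by (simp add: linorder_not_less[symmetric])

lemma mulholland_nonneg: "mulholland \<psi> \<Longrightarrow> 0 \<le> x \<Longrightarrow> 0 \<le> \<psi> x"
  by (auto simp: mulholland_def)

lemma mulholland_zero: "mulholland \<psi> \<Longrightarrow> \<psi> 0 = 0"
  by (simp add: mulholland_def)

lemma mulholland_pos: "mulholland \<psi> \<Longrightarrow> 0 < x \<Longrightarrow> 0 < \<psi> x"
  using mulholland_less_iff[of \<psi> 0 x] by (simp add: mulholland_zero)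

lemma nonneg_inv_less_iff:
  assumes "mulholland \<psi>" "0 \<le> u" "0 \<le> r"
  shows "nonneg_inv \<psi> u < r \<longleftrightarrow> u < \<psi> r"
  using mulholland_less_iff[OF assms(1) mulholland_nonneg_inv(1)[OF assms(1,2)] assms(3)]
    mulholland_nonneg_inv(2)[OF assms(1,2)] by simp

lemma nonneg_inv_pos:
  assumes "mulholland \<psi>" "0 < u"
  shows "0 < nonneg_inv \<psi> u"
proof -
  have "\<psi> (nonneg_inv \<psi> u) \<noteq> \<psi> 0"
    using mulholland_nonneg_inv(2)[of \<psi> u] mulholland_zero[of \<psi>] assms by simp
  then have "nonneg_inv \<psi> u \<noteq> 0" by auto
  then show ?thesis using mulholland_nonneg_inv(1)[of \<psi> u] assms by simp
qed

lemma nonneg_inv_mono: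
  assumes "mulholland \<psi>" "0 \<le> u" "u \<le> w"
  shows "nonneg_inv \<psi> u \<le> nonneg_inv \<psi> w"
  using mulholland_le_iff[of \<psi> "nonneg_inv \<psi> u" "nonneg_inv \<psi> w"]
    mulholland_nonneg_inv[of \<psi> u] mulholland_nonneg_inv[of \<psi> w] assms by simp

lemma mulholland_measurable:
  assumes "mulholland \<psi>" "f \<in> borel_measurable M" "\<And>x. 0 \<le> f x"
  shows "(\<lambda>x. \<psi> (f x)) \<in> borel_measurable M"
proof -
  have "continuous_on UNIV (\<lambda>x. \<psi> (max 0 x))"
    using assms(1) by (intro continuous_on_compose2[of "{0..}" \<psi> UNIV "max 0"])
      (auto simp: mulholland_def intro!: continuous_on_max)
  then have "(\<lambda>x. \<psi> (max 0 x)) \<in> borel_measurable borel"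
    by (rule borel_measurable_continuous_onI)
  from measurable_compose[OF assms(2) this] show ?thesis
    using assms(3) by (simp add: max_absorb2)
qed

lemma region_emeasure:
  assumes "P \<in> regions"
  shows "emeasure lborel P \<noteq> 0" "emeasure lborel P \<noteq> \<infinity>" "0 < measure lborel P" "P \<in> sets borel"
proof -
  show b: "P \<in> sets borel" using assms by (auto simp: regions_def)
  have "P \<noteq> {}" "open P" using assms by (auto simp: regions_def)
  then have n: "\<not> negligible P" using open_not_negligible by blast
  show e: "emeasure lborel P \<noteq> 0"
  proof
    assume "emeasure lborel P = 0"
    then have "P \<in> null_sets lborel" using b by auto
    then show False using n null_sets_completionI[of P lborel] by (simp add: negligible_iff_null_sets)
  qed
  show f: "emeasure lborel P \<noteq> \<infinity>"
    using assms emeasure_bounded_finite[of P] by (auto simp: regions_def)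
  show "0 < measure lborel P"
    using e f by (simp add: measure_def enn2real_positive_iff top.not_eq_extremum zero_less_iff_neq_zero)
qed

lemma prob_space_uniform_region: "P \<in> regions \<Longrightarrow> prob_space (uniform_measure lborel P)"
  by (intro prob_space_uniform_measure region_emeasure)

lemma measure_uniform_region:
  assumes "P \<in> regions" "S \<in> sets borel"
  shows "measure (uniform_measure lborel P) S = measure lborel (P \<inter> S) / measure lborel P"
  using region_emeasure[OF assms(1)] assms(2) by (simp add: measure_uniform_measure)

definition mean_cost :: "(real \<Rightarrow> real) \<Rightarrow> 'a::euclidean_space set \<Rightarrow> ('a \<Rightarrow> 'a) \<Rightarrow> real" where
  "mean_cost \<psi> P \<gamma> = (\<integral>x. \<psi> (dist x (\<gamma> x)) \<partial>uniform_measure lborel P)"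

lemma cost_measurable:
  fixes \<gamma> :: "'a::euclidean_space \<Rightarrow> 'a"
  assumes "mulholland \<psi>" "\<gamma> \<in> borel_measurable borel"
  shows "(\<lambda>x. \<psi> (dist x (\<gamma> x))) \<in> borel_measurable borel"
proof (rule mulholland_measurable[OF assms(1)])
  note [measurable] = assms(2)
  show "(\<lambda>x. dist x (\<gamma> x)) \<in> borel_measurable borel"
    by measurable
qed simp

lemma mean_cost_eq:
  assumes "mulholland \<psi>" "P \<in> regions" "\<gamma> \<in> borel_measurable borel"
  shows "mean_cost \<psi> P \<gamma> = 1 / measure lborel P * (LINT x:P|lborel. \<psi> (dist x (\<gamma> x)))"
proof -
  let ?w = "\<lambda>x. indicator P x / measure lborel P"
  note [measurable] = cost_measurable[OF assms(1,3)] region_emeasure(4)[OF assms(2)]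
  have m: "?w \<in> borel_measurable lborel"
    by measurable
  have pos: "0 < measure lborel P" by (rule region_emeasure) fact
  have e: "emeasure lborel P = ennreal (measure lborel P)"
    using region_emeasure(2)[OF assms(2)] by (intro emeasure_eq_ennreal_measure) auto
  have "indicator P x / emeasure lborel P = ennreal (?w x)" for x
  proof -
    have "ennreal (?w x) = ennreal (indicator P x) / ennreal (measure lborel P)"
      using pos by (intro divide_ennreal[symmetric]) auto
    then show ?thesis by (simp add: e ennreal_indicator)
  qed
  then have "uniform_measure lborel P = density lborel (\<lambda>x. ennreal (?w x))"
    unfolding uniform_measure_def by simp
  then have "mean_cost \<psi> P \<gamma> = (\<integral>x. ?w x *\<^sub>R \<psi> (dist x (\<gamma> x)) \<partial>lborel)"
    unfolding mean_cost_def using m pos by (simp add: integral_density)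
  also have "\<dots> = (\<integral>x. (1 / measure lborel P) * (indicator P x *\<^sub>R \<psi> (dist x (\<gamma> x))) \<partial>lborel)"
    by (intro Bochner_Integration.integral_cong) (auto split: split_indicator)
  finally show ?thesis
    unfolding set_lebesgue_integral_def by simp
qed

lemma wasserstein_eq:
  assumes "mulholland \<psi>" "P \<in> regions"
  shows "wasserstein \<psi> P Q = (INF \<gamma>\<in>transport_maps P Q. nonneg_inv \<psi> (mean_cost \<psi> P \<gamma>))"
  unfolding wasserstein_def
  by (rule arg_cong[of _ _ Inf], rule image_cong)
    (simp_all add: mean_cost_eq[OF assms] transport_maps_def)

lemma transport_AE:
  assumes "P \<in> regions" "Q \<in> regions" "\<gamma> \<in> transport_maps P Q"
  shows "AE x in uniform_measure lborel P. x \<in> P \<and> \<gamma> x \<in> Q"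
proof -
  note [measurable] = region_emeasure(4)[OF assms(1)] region_emeasure(4)[OF assms(2)]
  have [measurable]: "\<gamma> \<in> borel_measurable borel" using assms by (simp add: transport_maps_def)
  have "AE x in uniform_measure lborel Q. x \<in> Q"
    by (intro AE_uniform_measureI) auto
  moreover have "distr (uniform_measure lborel P) borel \<gamma> = uniform_measure lborel Q"
    using assms(3) by (simp add: transport_maps_def)
  ultimately have "AE x in distr (uniform_measure lborel P) borel \<gamma>. x \<in> Q"
    by metis
  then have 1: "AE x in uniform_measure lborel P. \<gamma> x \<in> Q"
    by (subst (asm) AE_distr_iff) auto
  have "AE x in uniform_measure lborel P. x \<in> P"
    by (intro AE_uniform_measureI) auto
  with 1 show ?thesis by eventually_elim simp
qed

lemma cost_integrable:
  assumes "mulholland \<psi>" "P \<in> regions" "Q \<in> regions" "\<gamma> \<in> transport_maps P Q"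
  shows "integrable (uniform_measure lborel P) (\<lambda>x. \<psi> (dist x (\<gamma> x)))"
proof -
  interpret prob_space "uniform_measure lborel P" by (rule prob_space_uniform_region) fact
  have "bounded (P \<union> Q)" using assms by (auto simp: regions_def)
  then obtain D where D: "\<And>x y. x \<in> P \<union> Q \<Longrightarrow> y \<in> P \<union> Q \<Longrightarrow> dist x y \<le> D"
    unfolding bounded_two_points by blast
  have "\<gamma> \<in> borel_measurable borel" using assms by (simp add: transport_maps_def)
  from cost_measurable[OF assms(1) this]
  show ?thesis
  proof (intro integrable_const_bound[of _ "\<psi> (max 0 D)"])
    show "AE x in uniform_measure lborel P. norm (\<psi> (dist x (\<gamma> x))) \<le> \<psi> (max 0 D)"
      using transport_AE[OF assms(2-4)]
    proof eventually_elim
      case (elim x)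
      then have "dist x (\<gamma> x) \<le> max 0 D" using D[of x "\<gamma> x"] by auto
      then show ?case
        using mulholland_le_iff[OF assms(1), of "dist x (\<gamma> x)" "max 0 D"]
          mulholland_nonneg[OF assms(1), of "dist x (\<gamma> x)"] by simp
    qed
  qed simp
qed

lemma mean_cost_nonneg: "mulholland \<psi> \<Longrightarrow> 0 \<le> mean_cost \<psi> P \<gamma>"
  unfolding mean_cost_def by (intro Bochner_Integration.integral_nonneg) (simp add: mulholland_nonneg)

lemma wasserstein_le:
  assumes "mulholland \<psi>" "P \<in> regions" "\<gamma> \<in> transport_maps P Q"
  shows "wasserstein \<psi> P Q \<le> nonneg_inv \<psi> (mean_cost \<psi> P \<gamma>)"
  unfolding wasserstein_eq[OF assms(1,2)]
proof (rule cINF_lower)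
  show "bdd_below ((\<lambda>\<gamma>. nonneg_inv \<psi> (mean_cost \<psi> P \<gamma>)) ` transport_maps P Q)"
    by (rule bdd_belowI[of _ 0]) (auto intro: mulholland_nonneg_inv(1)[OF assms(1)] mean_cost_nonneg[OF assms(1)])
qed fact

lemma wasserstein_ge:
  assumes \<psi>: "mulholland \<psi>" and "P \<in> regions" "Q \<in> regions" "transport_maps P Q \<noteq> {}" "0 \<le> p" "0 \<le> \<rho>"
    and far: "\<And>\<gamma>. \<gamma> \<in> transport_maps P Q \<Longrightarrow>
      p \<le> measure (uniform_measure lborel P) {x. \<rho> \<le> dist x (\<gamma> x)}"
  shows "nonneg_inv \<psi> (\<psi> \<rho> * p) \<le> wasserstein \<psi> P Q"
  unfolding wasserstein_eq[OF \<psi> assms(2)]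
proof (intro cINF_greatest assms)
  fix \<gamma> assume \<gamma>: "\<gamma> \<in> transport_maps P Q"
  interpret prob_space "uniform_measure lborel P" by (rule prob_space_uniform_region) fact
  let ?S = "{x. \<rho> \<le> dist x (\<gamma> x)}"
  have [measurable]: "\<gamma> \<in> borel_measurable borel" using \<gamma> by (simp add: transport_maps_def)
  have S: "?S \<in> sets borel" by measurable
  have "\<psi> \<rho> * p \<le> (\<integral>x. \<psi> \<rho> * indicator ?S x \<partial>uniform_measure lborel P)"
    using far[OF \<gamma>] mulholland_nonneg[OF \<psi>, of \<rho>] assms S by (simp add: mult_left_mono)
  also have "\<dots> \<le> mean_cost \<psi> P \<gamma>"
    unfolding mean_cost_def
  proof (rule integral_mono)
    show "integrable (uniform_measure lborel P) (\<lambda>x. \<psi> \<rho> * indicator ?S x)"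
      using S by (intro integrable_mult_right integrable_real_indicator) (auto simp: emeasure_eq_measure)
    show "\<psi> \<rho> * indicator ?S x \<le> \<psi> (dist x (\<gamma> x))" for x
      using mulholland_le_iff[OF \<psi> assms(6), of "dist x (\<gamma> x)"] mulholland_nonneg[OF \<psi>, of "dist x (\<gamma> x)"]
      by (simp split: split_indicator)
  qed (rule cost_integrable[OF \<psi> assms(2,3) \<gamma>])
  finally show "nonneg_inv \<psi> (\<psi> \<rho> * p) \<le> nonneg_inv \<psi> (mean_cost \<psi> P \<gamma>)"
    using assms mulholland_nonneg[OF \<psi>, of \<rho>] by (intro nonneg_inv_mono) auto
qed

lemma measure_transport:
  assumes "P \<in> regions" "Q \<in> regions" "\<gamma> \<in> transport_maps P Q" "T \<in> sets borel"
  shows "measure (uniform_measure lborel P) {x. \<gamma> x \<in> T} = measure lborel (Q \<inter> T) / measure lborel Q"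
proof -
  have [measurable]: "\<gamma> \<in> borel_measurable borel" using assms by (simp add: transport_maps_def)
  have "measure (uniform_measure lborel P) {x. \<gamma> x \<in> T} = measure (distr (uniform_measure lborel P) borel \<gamma>) T"
    using assms(4) by (subst measure_distr) (auto simp: vimage_def)
  also have "\<dots> = measure (uniform_measure lborel Q) T"
    using assms(3) by (simp add: transport_maps_def)
  finally show ?thesis using measure_uniform_region assms by simp
qed

lemma wasserstein_ge_source:
  assumes "mulholland \<psi>" "P \<in> regions" "Q \<in> regions" "transport_maps P Q \<noteq> {}" "0 \<le> \<rho>" "S \<in> sets borel"
    and far: "\<And>x y. x \<in> P \<inter> S \<Longrightarrow> y \<in> Q \<Longrightarrow> \<rho> \<le> dist x y"
  shows "nonneg_inv \<psi> (\<psi> \<rho> * (measure lborel (P \<inter> S) / measure lborel P)) \<le> wasserstein \<psi> P Q"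
proof (rule wasserstein_ge[OF assms(1-4) _ assms(5)])
  fix \<gamma> assume \<gamma>: "\<gamma> \<in> transport_maps P Q"
  interpret prob_space "uniform_measure lborel P" by (rule prob_space_uniform_region) fact
  have [measurable]: "\<gamma> \<in> borel_measurable borel" using \<gamma> by (simp add: transport_maps_def)
  have "measure (uniform_measure lborel P) S \<le> measure (uniform_measure lborel P) {x. \<rho> \<le> dist x (\<gamma> x)}"
  proof (rule finite_measure_mono_AE)
    show "AE x in uniform_measure lborel P. x \<in> S \<longrightarrow> x \<in> {x. \<rho> \<le> dist x (\<gamma> x)}"
      using transport_AE[OF assms(2,3) \<gamma>] by eventually_elim (auto intro: far)
  qed simp
  then show "measure lborel (P \<inter> S) / measure lborel P \<le> measure (uniform_measure lborel P) {x. \<rho> \<le> dist x (\<gamma> x)}"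
    using measure_uniform_region[OF assms(2,6)] by simp
qed simp

lemma wasserstein_ge_target:
  assumes "mulholland \<psi>" "P \<in> regions" "Q \<in> regions" "transport_maps P Q \<noteq> {}" "0 \<le> \<rho>" "T \<in> sets borel"
    and far: "\<And>x y. x \<in> P \<Longrightarrow> y \<in> Q \<inter> T \<Longrightarrow> \<rho> \<le> dist x y"
  shows "nonneg_inv \<psi> (\<psi> \<rho> * (measure lborel (Q \<inter> T) / measure lborel Q)) \<le> wasserstein \<psi> P Q"
proof (rule wasserstein_ge[OF assms(1-4) _ assms(5)])
  fix \<gamma> assume \<gamma>: "\<gamma> \<in> transport_maps P Q"
  interpret prob_space "uniform_measure lborel P" by (rule prob_space_uniform_region) fact
  have [measurable]: "\<gamma> \<in> borel_measurable borel" using \<gamma> by (simp add: transport_maps_def)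
  have "measure (uniform_measure lborel P) {x. \<gamma> x \<in> T} \<le> measure (uniform_measure lborel P) {x. \<rho> \<le> dist x (\<gamma> x)}"
  proof (rule finite_measure_mono_AE)
    show "AE x in uniform_measure lborel P. x \<in> {x. \<gamma> x \<in> T} \<longrightarrow> x \<in> {x. \<rho> \<le> dist x (\<gamma> x)}"
      using transport_AE[OF assms(2,3) \<gamma>] by eventually_elim (auto intro: far)
  qed simp
  then show "measure lborel (Q \<inter> T) / measure lborel Q \<le> measure (uniform_measure lborel P) {x. \<rho> \<le> dist x (\<gamma> x)}"
    using measure_transport[OF assms(2,3) \<gamma> assms(6)] by simp
qed simp

section \<open>Comparison of the two distances\<close>

lemma mulholland_dominated:
  assumes "mulholland \<alpha>" "mulholland \<beta>" "((\<lambda>x. \<alpha> x / \<beta> x) \<longlongrightarrow> 0) at_top" "0 < \<delta>"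
  shows "\<exists>C>0. \<forall>t\<ge>0. \<alpha> t \<le> \<alpha> \<delta> + C * \<beta> t"
proof -
  have "eventually (\<lambda>x. \<alpha> x / \<beta> x < 1) at_top"
    using order_tendstoD(2)[OF assms(3)] by simp
  then obtain T where T: "\<And>x. x \<ge> T \<Longrightarrow> \<alpha> x / \<beta> x < 1"
    by (auto simp: eventually_at_top_linorder)
  define T' where "T' = max T (max \<delta> 1)"
  define C where "C = max 1 (\<alpha> T' / \<beta> \<delta>)"
  have "\<alpha> t \<le> \<alpha> \<delta> + C * \<beta> t" if "0 \<le> t" for t
  proof (cases "t \<le> \<delta>")
    case True
    then have "\<alpha> t \<le> \<alpha> \<delta>" using that assms by (simp add: mulholland_le_iff)
    moreover have "0 \<le> C * \<beta> t" using mulholland_nonneg[OF assms(2) that] by (auto simp: C_def intro!: mult_nonneg_nonneg)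
    ultimately show ?thesis by simp
  next
    case False
    have pos: "0 < \<beta> \<delta>" "0 < \<beta> t" "0 \<le> \<alpha> \<delta>" using False assms(4) mulholland_pos[OF assms(2)] mulholland_nonneg[OF assms(1)] by auto
    have "\<alpha> t \<le> C * \<beta> t"
    proof (cases "t \<le> T'")
      case True
      have "\<alpha> t \<le> \<alpha> T'" using True that assms by (simp add: mulholland_le_iff T'_def)
      also have "\<dots> = \<alpha> T' / \<beta> \<delta> * \<beta> \<delta>" using pos by simp
      also have "\<dots> \<le> C * \<beta> t"
        using False assms pos mulholland_nonneg[OF assms(1)]
        by (intro mult_mono) (auto simp: C_def mulholland_le_iff)
      finally show ?thesis .
    next
      case F: False
      then have "\<alpha> t \<le> 1 * \<beta> t" using T[of t] pos by (simp add: T'_def less_imp_le)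
      also have "\<dots> \<le> C * \<beta> t" using pos by (intro mult_right_mono) (auto simp: C_def)
      finally show ?thesis .
    qed
    then show ?thesis using pos by simp
  qed
  moreover have "C > 0" by (simp add: C_def)
  ultimately show ?thesis by blast
qed

lemma wasserstein_dominated:
  assumes \<alpha>: "mulholland \<alpha>" and \<beta>: "mulholland \<beta>" and lim: "((\<lambda>x. \<alpha> x / \<beta> x) \<longlongrightarrow> 0) at_top"
    and r: "0 < r"
  shows "\<exists>s>0. \<forall>P\<in>regions. \<forall>Q\<in>regions. wasserstein \<beta> P Q < s \<longrightarrow> wasserstein \<alpha> P Q < r"
proof -
  obtain C where C: "C > 0" "\<And>t. t \<ge> 0 \<Longrightarrow> \<alpha> t \<le> \<alpha> (r/2) + C * \<beta> t"
    using mulholland_dominated[OF \<alpha> \<beta> lim, of "r/2"] r by auto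
  define \<epsilon> where "\<epsilon> = (\<alpha> r - \<alpha> (r/2)) / C"
  have \<epsilon>: "0 < \<epsilon>" using C r \<alpha> by (simp add: \<epsilon>_def mulholland_less_iff)
  define s where "s = min r (nonneg_inv \<beta> \<epsilon>)"
  have inv: "\<beta> (nonneg_inv \<beta> \<epsilon>) = \<epsilon>" "0 \<le> nonneg_inv \<beta> \<epsilon>"
    using mulholland_nonneg_inv[OF \<beta>] \<epsilon> by auto
  have "s > 0" using nonneg_inv_pos[OF \<beta> \<epsilon>] r by (simp add: s_def)
  moreover have "wasserstein \<alpha> P Q < r" if P: "P \<in> regions" and Q: "Q \<in> regions"
    and W: "wasserstein \<beta> P Q < s" for P Q :: "'a set"
  proof (cases "transport_maps P Q = {}")
    \<comment> \<open>both infima are then the same unspecified number, whence the bound \<open>s \<le> r\<close>\<close>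
    case True
    then show ?thesis using W by (simp add: s_def wasserstein_def)
  next
    case False
    then obtain \<gamma> where \<gamma>: "\<gamma> \<in> transport_maps P Q" "nonneg_inv \<beta> (mean_cost \<beta> P \<gamma>) < s"
      using cInf_lessD[of "(\<lambda>\<gamma>. nonneg_inv \<beta> (mean_cost \<beta> P \<gamma>)) ` transport_maps P Q" s]
        W unfolding wasserstein_eq[OF \<beta> P] by auto
    interpret prob_space "uniform_measure lborel P" by (rule prob_space_uniform_region) fact
    have "mean_cost \<beta> P \<gamma> < \<epsilon>"
      using \<gamma>(2) nonneg_inv_less_iff[OF \<beta> mean_cost_nonneg[OF \<beta>, of P \<gamma>] inv(2)] inv(1) by (simp add: s_def)
    then have lt: "C * mean_cost \<beta> P \<gamma> < \<alpha> r - \<alpha> (r/2)"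
      using C(1) by (simp add: \<epsilon>_def field_simps)
    have "mean_cost \<alpha> P \<gamma> \<le> (\<integral>x. \<alpha> (r/2) + C * \<beta> (dist x (\<gamma> x)) \<partial>uniform_measure lborel P)"
      unfolding mean_cost_def
      using cost_integrable[OF \<alpha> P Q \<gamma>(1)] cost_integrable[OF \<beta> P Q \<gamma>(1)] C(2)
      by (intro integral_mono) auto
    also have "\<dots> = \<alpha> (r/2) + C * mean_cost \<beta> P \<gamma>"
      unfolding mean_cost_def using cost_integrable[OF \<beta> P Q \<gamma>(1)] prob_space by simp
    also have "\<dots> < \<alpha> r" using lt by simp
    finally have "nonneg_inv \<alpha> (mean_cost \<alpha> P \<gamma>) < r"
      using nonneg_inv_less_iff[OF \<alpha> mean_cost_nonneg[OF \<alpha>, of P \<gamma>]] r by simp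
    then show ?thesis using wasserstein_le[OF \<alpha> P \<gamma>(1)] by simp
  qed
  ultimately show ?thesis by blast
qed

section \<open>Existence of transport maps\<close>

lemma emeasure_lborel_translate:
  fixes A :: "'a::euclidean_space set"
  assumes [measurable]: "A \<in> sets borel"
  shows "emeasure lborel {x. x + t \<in> A} = emeasure lborel A"
proof -
  have "emeasure (distr lborel borel ((+) t)) A = emeasure lborel {x. x + t \<in> A}"
    by (subst emeasure_distr) (auto simp: vimage_def add.commute)
  then show ?thesis by (simp add: lborel_distr_plus)
qed

lemma nn_integral_overlap:
  fixes A B :: "'a::euclidean_space set"
  assumes [measurable]: "A \<in> sets borel" "B \<in> sets borel"
  shows "(\<integral>\<^sup>+t. emeasure lborel {x \<in> A. x + t \<in> B} \<partial>lborel) = emeasure lborel A * emeasure lborel B"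
proof -
  have "(\<integral>\<^sup>+t. emeasure lborel {x \<in> A. x + t \<in> B} \<partial>lborel) =
      (\<integral>\<^sup>+t. (\<integral>\<^sup>+x. indicator A x * indicator B (x + t) \<partial>lborel) \<partial>lborel)"
  proof (intro nn_integral_cong)
    fix t :: 'a
    have "emeasure lborel {x \<in> A. x + t \<in> B} = (\<integral>\<^sup>+x. indicator {x \<in> A. x + t \<in> B} x \<partial>lborel)"
      by (subst nn_integral_indicator) auto
    also have "\<dots> = (\<integral>\<^sup>+x. indicator A x * indicator B (x + t) \<partial>lborel)"
      by (intro nn_integral_cong) (auto split: split_indicator)
    finally show "emeasure lborel {x \<in> A. x + t \<in> B} = \<dots>" .
  qed
  also have "\<dots> = (\<integral>\<^sup>+x. (\<integral>\<^sup>+t. indicator A x * indicator B (x + t) \<partial>lborel) \<partial>lborel)"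
    by (rule lborel_pair.Fubini') measurable
  also have "\<dots> = (\<integral>\<^sup>+x. emeasure lborel B * indicator A x \<partial>lborel)"
  proof (intro nn_integral_cong)
    fix x :: 'a
    have "(\<integral>\<^sup>+t. indicator A x * indicator B (x + t) \<partial>lborel) =
        (\<integral>\<^sup>+t. indicator A x * indicator {t. t + x \<in> B} t \<partial>lborel)"
      by (intro nn_integral_cong) (auto split: split_indicator simp: add.commute)
    also have "\<dots> = indicator A x * emeasure lborel {t. t + x \<in> B}"
      by (subst nn_integral_cmult_indicator) auto
    finally show "(\<integral>\<^sup>+t. indicator A x * indicator B (x + t) \<partial>lborel) = emeasure lborel B * indicator A x"
      by (simp add: emeasure_lborel_translate mult.commute)
  qed
  finally show ?thesis
    by (subst (asm) nn_integral_cmult_indicator) (auto simp: mult.commute)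
qed

lemma exists_large_overlap:
  fixes A B :: "'a::euclidean_space set"
  assumes [measurable]: "A \<in> sets borel" "B \<in> sets borel" and fin: "emeasure lborel A \<noteq> \<infinity>"
  shows "\<exists>t. \<forall>s. measure lborel {x \<in> A. x + s \<in> B} \<le> 2 * measure lborel {x \<in> A. x + t \<in> B}"
proof -
  let ?m = "\<lambda>s. measure lborel {x \<in> A. x + s \<in> B}"
  have le: "?m s \<le> measure lborel A" for s
    using fin by (intro measure_mono_fmeasurable) (auto simp: fmeasurable_def top.not_eq_extremum)
  have bdd: "bdd_above (range ?m)"
    using le by (intro bdd_aboveI[of _ "measure lborel A"]) auto
  show ?thesis
  proof (cases "\<exists>t. 0 < ?m t")
    case True
    then obtain t0 where "0 < ?m t0" by blast
    moreover have "?m t0 \<le> (SUP s. ?m s)" by (rule cSUP_upper[OF _ bdd]) simp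
    ultimately have "(SUP s. ?m s) / 2 < (SUP s. ?m s)" by linarith
    then obtain t where "(SUP s. ?m s) / 2 < ?m t"
      using less_cSUP_iff[OF _ bdd, of "(SUP s. ?m s) / 2"] by blast
    moreover have "?m s \<le> (SUP s. ?m s)" for s by (rule cSUP_upper[OF _ bdd]) simp
    ultimately show ?thesis
      by (intro exI[of _ t] allI) (smt (verit, ccfv_threshold) field_sum_of_halves)
  next
    case False
    then have "?m s = 0" for s by (meson linorder_not_less measure_nonneg order_antisym)
    then show ?thesis by simp
  qed
qed

text \<open>
  Greedy exhaustion: keep translating the part of \<open>A\<close> that a nearly optimal translation maps
  into \<open>B\<close>. The remainders overlap negligibly under every translation, so by Fubini they are null.
\<close>

lemma equal_measure_transport:
  fixes A B :: "'a::euclidean_space set"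
  assumes A: "A \<in> sets borel" and B: "B \<in> sets borel"
    and fin: "emeasure lborel A \<noteq> \<infinity>" and eq: "emeasure lborel A = emeasure lborel B"
  shows "\<exists>\<gamma>\<in>borel_measurable borel. \<forall>S\<in>sets borel.
           emeasure lborel (A \<inter> \<gamma> -` S) = emeasure lborel (B \<inter> S)"
proof -
  let ?O = "\<lambda>A B t. {x \<in> A. x + t \<in> B}"
  define inv where "inv n AB \<longleftrightarrow> (n = 0 \<longrightarrow> AB = (A, B)) \<and>
      fst AB \<in> sets borel \<and> snd AB \<in> sets borel \<and> fst AB \<subseteq> A" for n :: nat and AB
  define step where "step AB AB' t \<longleftrightarrow>
      fst AB' = fst AB - ?O (fst AB) (snd AB) t \<and>
      snd AB' = snd AB - {y \<in> snd AB. y - t \<in> fst AB} \<and>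
      (\<forall>s. measure lborel (?O (fst AB) (snd AB) s) \<le> 2 * measure lborel (?O (fst AB) (snd AB) t))"
    for AB AB' :: "'a set \<times> 'a set" and t
  have "\<exists>f. \<forall>n. inv n (f n) \<and> (\<exists>t. step (f n) (f (Suc n)) t)"
  proof (rule dependent_nat_choice)
    show "\<exists>x. inv 0 x" unfolding inv_def using A B by (intro exI[of _ "(A, B)"]) simp
    fix AB n assume inv: "inv n AB"
    obtain A' B' where AB: "AB = (A', B')" by (cases AB)
    have AB': "A' \<in> sets borel" "B' \<in> sets borel" "A' \<subseteq> A" using inv AB by (auto simp: inv_def)
    note [measurable] = AB'(1,2)
    have "emeasure lborel A' \<le> emeasure lborel A"
      using AB' A by (intro emeasure_mono) auto
    then have "emeasure lborel A' \<noteq> \<infinity>" using fin by (auto simp: top_unique)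
    from exists_large_overlap[OF AB'(1,2) this] obtain t
      where t: "\<forall>s. measure lborel (?O A' B' s) \<le> 2 * measure lborel (?O A' B' t)"
      by (rule exE)
    have "A' - ?O A' B' t \<in> sets borel" "B' - {y \<in> B'. y - t \<in> A'} \<in> sets borel"
      by measurable
    then have "inv (Suc n) (A' - ?O A' B' t, B' - {y \<in> B'. y - t \<in> A'})"
      using AB'(3) by (auto simp: inv_def)
    moreover have "step AB (A' - ?O A' B' t, B' - {y \<in> B'. y - t \<in> A'}) t"
      using t by (simp add: step_def AB)
    ultimately show "\<exists>y. inv (Suc n) y \<and> (\<exists>t. step AB y t)" by blast
  qed
  then obtain f where f: "\<And>n. inv n (f n)" "\<And>n. \<exists>t. step (f n) (f (Suc n)) t" by blast
  then obtain t where step: "\<And>n. step (f n) (f (Suc n)) (t n)" by metis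
  define As where "As n = fst (f n)" for n
  define Bs where "Bs n = snd (f n)" for n
  define C where "C n = ?O (As n) (Bs n) (t n)" for n
  define D where "D n = {y \<in> Bs n. y - t n \<in> As n}" for n
  have zero: "As 0 = A" "Bs 0 = B" using f(1)[of 0] by (auto simp: inv_def As_def Bs_def)
  have meas[measurable]: "As n \<in> sets borel" "Bs n \<in> sets borel" for n
    using f(1)[of n] by (auto simp: inv_def As_def Bs_def)
  have [measurable]: "C n \<in> sets borel" "D n \<in> sets borel" for n
    unfolding C_def D_def by measurable
  note [measurable] = A B
  have Suc: "As (Suc n) = As n - C n" "Bs (Suc n) = Bs n - D n" for n
    using step[of n] by (auto simp: step_def As_def Bs_def C_def D_def)
  have opt: "measure lborel (?O (As n) (Bs n) s) \<le> 2 * measure lborel (C n)" for n s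
    using step[of n] by (auto simp: step_def As_def Bs_def C_def)
  have Aseq: "As n = A - (\<Union>k<n. C k)" and Bseq: "Bs n = B - (\<Union>k<n. D k)" for n
    by (induction n) (auto simp: zero Suc lessThan_Suc)
  have CA: "C n \<subseteq> As n" and DB: "D n \<subseteq> Bs n" for n by (auto simp: C_def D_def)
  have disjC: "disjoint_family C"
  proof -
    have "C m \<inter> C n = {}" if "m < n" for m n using that CA[of n] Aseq[of n] by auto
    then show ?thesis unfolding disjoint_family_on_def by (metis Int_commute nat_neq_iff)
  qed
  have disjD: "disjoint_family D"
  proof -
    have "D m \<inter> D n = {}" if "m < n" for m n using that DB[of n] Bseq[of n] by auto
    then show ?thesis unfolding disjoint_family_on_def by (metis Int_commute nat_neq_iff)
  qed
  have CD: "C n \<inter> {x. x + t n \<in> S} = {x. x + t n \<in> D n \<inter> S}" for n S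
    by (auto simp: C_def D_def)
  have emCD: "emeasure lborel (C n \<inter> {x. x + t n \<in> S}) = emeasure lborel (D n \<inter> S)"
    if [measurable]: "S \<in> sets borel" for n S
    unfolding CD by (rule emeasure_lborel_translate) measurable
  define UC where "UC = (\<Union>n. C n)"
  define UD where "UD = (\<Union>n. D n)"
  have [measurable]: "UC \<in> sets borel" "UD \<in> sets borel" unfolding UC_def UD_def by measurable
  have "C n \<subseteq> A" "D n \<subseteq> B" for n
    using CA[of n] DB[of n] by (auto simp: Aseq Bseq)
  then have sub: "UC \<subseteq> A" "UD \<subseteq> B" by (auto simp: UC_def UD_def)
  have UCD: "emeasure lborel UC = emeasure lborel UD"
    unfolding UC_def UD_def using emCD[of UNIV] disjC disjD
    by (subst (1 2) suminf_emeasure[symmetric]) auto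
  have finB: "emeasure lborel B \<noteq> \<infinity>" using fin eq by simp
  have finUC: "emeasure lborel UC \<noteq> \<infinity>"
    using emeasure_mono[OF sub(1), of lborel] fin A by (auto simp: top_unique)
  have rest: "emeasure lborel (A - UC) = emeasure lborel (B - UD)"
    using sub finUC UCD eq by (subst (1 2) emeasure_Diff) auto
  have "(\<lambda>n. measure lborel (C n)) sums measure lborel UC"
    unfolding UC_def by (rule measure_UNION) (use disjC finUC in \<open>auto simp: UC_def\<close>)
  then have lim: "(\<lambda>n. 2 * measure lborel (C n)) \<longlonglongrightarrow> 2 * 0"
    by (intro tendsto_mult_left summable_LIMSEQ_zero) (auto simp: sums_iff)
  have null: "emeasure lborel (?O (A - UC) (B - UD) s) = 0" for s
  proof -
    have ff: "emeasure lborel X \<noteq> \<infinity>" if "X \<subseteq> A" for X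
      using emeasure_mono[OF that, of lborel] fin A by (auto simp: top_unique)
    have "measure lborel (?O (A - UC) (B - UD) s) \<le> 2 * measure lborel (C n)" for n
    proof -
      have "measure lborel (?O (A - UC) (B - UD) s) \<le> measure lborel (?O (As n) (Bs n) s)"
      proof (rule measure_mono_fmeasurable)
        show "?O (As n) (Bs n) s \<in> fmeasurable lborel"
          using ff[of "?O (As n) (Bs n) s"] by (auto simp: fmeasurable_def top.not_eq_extremum Aseq)
      qed (auto simp: Aseq Bseq UC_def UD_def)
      then show ?thesis using opt[of n s] by linarith
    qed
    then have "measure lborel (?O (A - UC) (B - UD) s) \<le> 2 * 0"
      by (intro LIMSEQ_le_const[OF lim]) blast
    then have "measure lborel (?O (A - UC) (B - UD) s) = 0"
      using measure_nonneg[of lborel] by (simp add: order_antisym)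
    then show ?thesis
      using ff[of "?O (A - UC) (B - UD) s"] by (subst emeasure_eq_ennreal_measure) auto
  qed
  have "emeasure lborel (A - UC) * emeasure lborel (B - UD) =
      (\<integral>\<^sup>+t. emeasure lborel (?O (A - UC) (B - UD) t) \<partial>lborel)"
    by (rule nn_integral_overlap[symmetric]) measurable
  also have "\<dots> = 0" unfolding null by simp
  finally have "emeasure lborel (A - UC) = 0 \<or> emeasure lborel (B - UD) = 0"
    by (simp only: mult_eq_0_iff)
  then have restA: "emeasure lborel (A - UC) = 0" and restB: "emeasure lborel (B - UD) = 0"
    unfolding rest by blast+
  define \<gamma> where "\<gamma> x = x + t (LEAST n. x \<in> C n)" for x
  have idx: "(LEAST k. x \<in> C k) = n" if "x \<in> C n" for x n
  proof -
    have "k = n" if k: "x \<in> C k" for k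
    proof (rule ccontr)
      assume "k \<noteq> n"
      then have "C k \<inter> C n = {}" using disjC by (simp add: disjoint_family_on_def)
      then show False using k \<open>x \<in> C n\<close> by (simp add: disjoint_iff)
    qed
    then have "n \<le> k" if "x \<in> C k" for k using that by simp
    with that show ?thesis by (rule Least_equality)
  qed
  have [measurable]: "\<gamma> \<in> borel_measurable borel"
    unfolding \<gamma>_def by measurable
  have "emeasure lborel (A \<inter> \<gamma> -` S) = emeasure lborel (B \<inter> S)" if [measurable]: "S \<in> sets borel" for S
  proof -
    have gS[measurable]: "\<gamma> -` S \<in> sets borel"
      using measurable_sets[of \<gamma> borel borel S] by simp
    have "emeasure lborel (A \<inter> \<gamma> -` S) = emeasure lborel (UC \<inter> \<gamma> -` S)"
    proof (rule emeasure_eq_AE)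
      have "A - UC \<in> null_sets lborel" using restA by (auto simp: null_sets_def)
      from AE_not_in[OF this] show "AE x in lborel. x \<in> A \<inter> \<gamma> -` S \<longleftrightarrow> x \<in> UC \<inter> \<gamma> -` S"
        by eventually_elim (use sub in auto)
    qed auto
    also have "UC \<inter> \<gamma> -` S = (\<Union>n. C n \<inter> \<gamma> -` S)" by (auto simp: UC_def)
    also have "emeasure lborel \<dots> = (\<Sum>n. emeasure lborel (C n \<inter> \<gamma> -` S))"
      using disjC by (intro suminf_emeasure[symmetric]) (auto simp: disjoint_family_on_def)
    also have "\<dots> = (\<Sum>n. emeasure lborel (D n \<inter> S))"
    proof -
      have "C n \<inter> \<gamma> -` S = C n \<inter> {x. x + t n \<in> S}" for n
        by (auto simp: \<gamma>_def idx)
      then show ?thesis by (simp add: emCD)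
    qed
    also have "\<dots> = emeasure lborel (\<Union>n. D n \<inter> S)"
      using disjD by (intro suminf_emeasure) (auto simp: disjoint_family_on_def)
    also have "(\<Union>n. D n \<inter> S) = UD \<inter> S" by (auto simp: UD_def)
    also have "emeasure lborel (UD \<inter> S) = emeasure lborel (B \<inter> S)"
    proof (rule emeasure_eq_AE)
      have "B - UD \<in> null_sets lborel" using restB by (auto simp: null_sets_def)
      from AE_not_in[OF this] show "AE x in lborel. x \<in> UD \<inter> S \<longleftrightarrow> x \<in> B \<inter> S"
        by eventually_elim (use sub in auto)
    qed auto
    finally show ?thesis .
  qed
  then show ?thesis by (intro bexI[of _ \<gamma>]) auto
qed

lemma emeasure_lborel_scale:
  fixes E :: "'a::euclidean_space set"
  assumes [measurable]: "E \<in> sets borel" and "0 < c"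
  shows "emeasure lborel E = ennreal (c ^ DIM('a)) * emeasure lborel {x. c *\<^sub>R x \<in> E}"
proof -
  have "lborel = density (distr lborel borel (\<lambda>x::'a. 0 + c *\<^sub>R x)) (\<lambda>_. \<bar>c\<bar> ^ DIM('a))"
    using assms(2) by (intro lborel_affine) simp
  then have "emeasure lborel E = emeasure (density (distr lborel borel (\<lambda>x::'a. 0 + c *\<^sub>R x)) (\<lambda>_. \<bar>c\<bar> ^ DIM('a))) E"
    by (rule arg_cong)
  also have "\<dots> = ennreal (c ^ DIM('a)) * emeasure lborel {x. c *\<^sub>R x \<in> E}"
    using assms(2) by (simp add: emeasure_density_const emeasure_distr vimage_def)
  finally show ?thesis .
qed

lemma transport_maps_nonempty:
  fixes P Q :: "'a::euclidean_space set"
  assumes P: "P \<in> regions" and Q: "Q \<in> regions"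
  shows "transport_maps P Q \<noteq> {}"
proof -
  note PQ = region_emeasure[OF P] region_emeasure[OF Q]
  note [measurable] = PQ(4) PQ(8)
  define k where "k = measure lborel Q / measure lborel P"
  define c where "c = root DIM('a) k"
  have k: "0 < k" using PQ by (simp add: k_def)
  have c: "0 < c" "c ^ DIM('a) = k"
    using k by (auto simp: c_def real_root_gt_zero real_root_pow_pos)
  define A where "A = {x. (1/c) *\<^sub>R x \<in> P}"
  have [measurable]: "A \<in> sets borel" unfolding A_def by measurable
  have scale: "emeasure lborel E = ennreal k * emeasure lborel {x. c *\<^sub>R x \<in> E}" if "E \<in> sets borel" for E :: "'a set"
    using emeasure_lborel_scale[OF that c(1)] c(2) by simp
  have Peq: "{x. c *\<^sub>R x \<in> A} = P" using c(1) by (auto simp: A_def)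
  have emP: "emeasure lborel P = ennreal (measure lborel P)"
    using PQ by (intro emeasure_eq_ennreal_measure) auto
  have emQ: "emeasure lborel Q = ennreal (measure lborel Q)"
    using PQ by (intro emeasure_eq_ennreal_measure) auto
  have kP: "ennreal k * emeasure lborel P = emeasure lborel Q"
    unfolding emP emQ using k PQ by (subst ennreal_mult[symmetric]) (auto simp: k_def)
  have "emeasure lborel A = emeasure lborel Q"
    using scale[of A] Peq kP by simp
  moreover from this have "emeasure lborel A \<noteq> \<infinity>" using PQ by simp
  ultimately obtain \<gamma> where [measurable]: "\<gamma> \<in> borel_measurable borel"
    and \<gamma>: "\<And>S. S \<in> sets borel \<Longrightarrow> emeasure lborel (A \<inter> \<gamma> -` S) = emeasure lborel (Q \<inter> S)"
    using equal_measure_transport[of A Q] by auto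
  let ?\<delta> = "\<lambda>x. \<gamma> (c *\<^sub>R x)"
  have "distr (uniform_measure lborel P) borel ?\<delta> = uniform_measure lborel Q"
  proof (rule measure_eqI)
    fix S assume "S \<in> sets (distr (uniform_measure lborel P) borel ?\<delta>)"
    then have S[measurable]: "S \<in> sets borel" by simp
    have [measurable]: "\<gamma> -` S \<in> sets borel"
      using measurable_sets[of \<gamma> borel borel S] by simp
    have "{x. c *\<^sub>R x \<in> A \<inter> \<gamma> -` S} = P \<inter> ?\<delta> -` S" using Peq by auto
    then have "ennreal k * emeasure lborel (P \<inter> ?\<delta> -` S) = emeasure lborel (Q \<inter> S)"
      using scale[of "A \<inter> \<gamma> -` S"] \<gamma>[OF S] by simp
    moreover have "(ennreal k * emeasure lborel (P \<inter> ?\<delta> -` S)) / (ennreal k * emeasure lborel P)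
        = emeasure lborel (P \<inter> ?\<delta> -` S) / emeasure lborel P"
      using divide_mult_eq[of "ennreal k" "emeasure lborel (P \<inter> ?\<delta> -` S)" "emeasure lborel P"] k
      by (simp add: mult.commute)
    ultimately have "emeasure lborel (P \<inter> ?\<delta> -` S) / emeasure lborel P = emeasure lborel (Q \<inter> S) / emeasure lborel Q"
      by (simp add: kP)
    moreover have "?\<delta> -` S \<in> sets borel"
      using measurable_sets[of ?\<delta> borel borel S] by simp
    ultimately show "emeasure (distr (uniform_measure lborel P) borel ?\<delta>) S = emeasure (uniform_measure lborel Q) S"
      by (subst emeasure_distr) auto
  qed simp
  then have "?\<delta> \<in> transport_maps P Q" by (simp add: transport_maps_def)
  then show ?thesis by blast
qed

section \<open>Separating regions\<close>

lemma union_separated_region: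
  assumes A: "A \<in> regions" and B: "B \<in> regions" and AB: "closure A \<inter> closure B = {}"
  shows "A \<union> B \<in> regions"
proof -
  have aux: "x \<in> interior (closure A)" if "x \<in> interior (closure (A \<union> B))" "x \<notin> closure B" for A B :: "'a set" and x
  proof (rule interiorI)
    show "open (interior (closure (A \<union> B)) - closure B)" by auto
    show "interior (closure (A \<union> B)) - closure B \<subseteq> closure A"
      using interior_subset[of "closure (A \<union> B)"] by (auto simp: closure_Un)
  qed (use that in auto)
  have "interior (closure (A \<union> B)) \<subseteq> A \<union> B"
  proof
    fix x assume x: "x \<in> interior (closure (A \<union> B))"
    show "x \<in> A \<union> B"
    proof (cases "x \<in> closure B")
      case True
      then have "x \<notin> closure A" using AB by auto
      then have "x \<in> interior (closure B)" using aux[of x B A] x by (simp add: Un_commute)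
      then show ?thesis using B by (simp add: regions_def)
    next
      case False
      then show ?thesis using aux[OF x] A by (simp add: regions_def)
    qed
  qed
  moreover have "A \<union> B \<subseteq> interior (closure (A \<union> B))"
    using A B by (intro interior_maximal closure_subset) (auto simp: regions_def)
  ultimately show ?thesis
    using A B by (auto simp: regions_def)
qed

lemma convex_or_pair_subset_regions: "convex_or_pair_regions \<subseteq> regions"
proof
  fix R :: "'a set" assume "R \<in> convex_or_pair_regions"
  then consider "R \<in> convex_regions"
    | X Y where "R = X \<union> Y" "X \<in> convex_regions" "Y \<in> convex_regions" "0 < setdist (closure X) (closure Y)"
    unfolding convex_or_pair_regions_def separated_convex_pairs_def by blast
  then show "R \<in> regions"
  proof cases
    case 2
    have "closure X \<inter> closure Y = {}"
      using 2(4) setdist_eq_0I by fastforce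
    with 2 show ?thesis by (auto simp: convex_regions_def intro: union_separated_region)
  qed (simp add: convex_regions_def)
qed

lemma box_region: "box l u \<noteq> {} \<Longrightarrow> box l u \<in> regions"
  by (simp add: regions_def bounded_box open_box closure_box interior_cbox)

lemma box_convex_region: "box l u \<noteq> {} \<Longrightarrow> box l u \<in> convex_regions"
  by (simp add: convex_regions_def box_region convex_box)

lemma distinct_regions_ball:
  fixes P Q :: "'a::euclidean_space set"
  assumes P: "P \<in> regions" and Q: "Q \<in> regions" and "P \<noteq> Q"
  shows "\<exists>c r. 0 < r \<and> (ball c (2 * r) \<subseteq> P \<and> ball c (2 * r) \<inter> Q = {} \<or>
                        ball c (2 * r) \<subseteq> Q \<and> ball c (2 * r) \<inter> P = {})"
proof -
  have aux: "\<exists>c r. 0 < r \<and> ball c (2 * r) \<subseteq> A \<and> ball c (2 * r) \<inter> B = {}"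
    if A: "A \<in> regions" and B: "B \<in> regions" and "\<not> A \<subseteq> B" for A B :: "'a set"
  proof -
    have "\<not> A \<subseteq> closure B"
    proof
      assume "A \<subseteq> closure B"
      then have "A \<subseteq> interior (closure B)" using A by (intro interior_maximal) (auto simp: regions_def)
      then show False using B \<open>\<not> A \<subseteq> B\<close> by (simp add: regions_def)
    qed
    then obtain c where "c \<in> A - closure B" by blast
    moreover have "open (A - closure B)" using A by (auto simp: regions_def)
    ultimately obtain e where e: "0 < e" "ball c e \<subseteq> A - closure B"
      by (meson openE)
    then show ?thesis
      using closure_subset[of B] by (intro exI[of _ c] exI[of _ "e / 2"]) auto
  qed
  from \<open>P \<noteq> Q\<close> have "\<not> P \<subseteq> Q \<or> \<not> Q \<subseteq> P" by blast
  then show ?thesis using aux[OF P Q] aux[OF Q P] by blast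
qed

lemma wasserstein_ge_ball_source:
  fixes P Q :: "'a::euclidean_space set"
  assumes \<psi>: "mulholland \<psi>" and P: "P \<in> regions" and Q: "Q \<in> regions" and "0 < r"
    and "ball c r \<subseteq> P" "ball c (2 * r) \<inter> Q = {}"
  shows "nonneg_inv \<psi> (\<psi> r * (measure lborel (ball c r) / measure lborel P)) \<le> wasserstein \<psi> P Q"
proof -
  have "r \<le> dist x y" if "x \<in> P \<inter> ball c r" "y \<in> Q" for x y
  proof -
    have "2 * r \<le> dist c y" using that assms(6) by force
    moreover have "dist c x < r" using that by simp
    ultimately show ?thesis using dist_triangle[of c y x] by linarith
  qed
  moreover have "P \<inter> ball c r = ball c r" using assms(5) by blast
  ultimately show ?thesis
    using wasserstein_ge_source[OF \<psi> P Q transport_maps_nonempty[OF P Q], of r "ball c r"] assms(4) by simp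
qed

lemma wasserstein_ge_ball_target:
  fixes P Q :: "'a::euclidean_space set"
  assumes \<psi>: "mulholland \<psi>" and P: "P \<in> regions" and Q: "Q \<in> regions" and "0 < r"
    and "ball c r \<subseteq> Q" "ball c (2 * r) \<inter> P = {}"
  shows "nonneg_inv \<psi> (\<psi> r * (measure lborel (ball c r) / measure lborel Q)) \<le> wasserstein \<psi> P Q"
proof -
  have "r \<le> dist x y" if "x \<in> P" "y \<in> Q \<inter> ball c r" for x y
  proof -
    have "2 * r \<le> dist c x" using that assms(6) by force
    moreover have "dist c y < r" using that by simp
    ultimately show ?thesis using dist_triangle[of c x y] by (simp add: dist_commute)
  qed
  moreover have "Q \<inter> ball c r = ball c r" using assms(5) by blast
  ultimately show ?thesis
    using wasserstein_ge_target[OF \<psi> P Q transport_maps_nonempty[OF P Q], of r "ball c r"] assms(4) by simp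
qed

lemma nonneg_inv_ball_pos:
  assumes \<psi>: "mulholland \<psi>" and P: "P \<in> regions" and "0 < r"
  shows "0 < nonneg_inv \<psi> (\<psi> r * (measure lborel (ball c r) / measure lborel P))" (is "0 < nonneg_inv \<psi> ?u")
proof -
  have "0 < measure lborel (ball c r)" using content_ball_pos[OF \<open>0 < r\<close>] by simp
  then have u: "0 < ?u" using mulholland_pos[OF \<psi> \<open>0 < r\<close>] region_emeasure(3)[OF P] by simp
  then show ?thesis by (rule nonneg_inv_pos[OF \<psi>])
qed

lemma wasserstein_pos:
  fixes P Q :: "'a::euclidean_space set"
  assumes \<psi>: "mulholland \<psi>" and P: "P \<in> regions" and Q: "Q \<in> regions" and "P \<noteq> Q"
  shows "0 < wasserstein \<psi> P Q"
proof -
  obtain c r where r: "0 < r" and "ball c (2 * r) \<subseteq> P \<and> ball c (2 * r) \<inter> Q = {} \<or>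
                        ball c (2 * r) \<subseteq> Q \<and> ball c (2 * r) \<inter> P = {}"
    using distinct_regions_ball[OF P Q \<open>P \<noteq> Q\<close>] by blast
  moreover have "ball c r \<subseteq> ball c (2 * r)" using r by (intro subset_ball) simp
  ultimately have "ball c r \<subseteq> P \<and> ball c (2 * r) \<inter> Q = {} \<or> ball c r \<subseteq> Q \<and> ball c (2 * r) \<inter> P = {}"
    by blast
  then show ?thesis
  proof
    assume "ball c r \<subseteq> P \<and> ball c (2 * r) \<inter> Q = {}"
    then show ?thesis
      using wasserstein_ge_ball_source[OF \<psi> P Q r] nonneg_inv_ball_pos[OF \<psi> P r] order_less_le_trans by blast
  next
    assume "ball c r \<subseteq> Q \<and> ball c (2 * r) \<inter> P = {}"
    then show ?thesis
      using wasserstein_ge_ball_target[OF \<psi> P Q r] nonneg_inv_ball_pos[OF \<psi> Q r] order_less_le_trans by blast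
  qed
qed

section \<open>The unit cube with a slab moved far away\<close>

text \<open>
  The bounds for the moved slab involve \<open>\<alpha> R\<close> and \<open>\<beta> (R - m)\<close>, and \<open>\<beta>\<close> may grow too fast for
  \<open>\<beta> R\<close> and \<open>\<beta> (R - m)\<close> to be comparable in general. With \<open>m = 1 / \<beta> (R - m)\<close> they are for
  arbitrarily large \<open>R\<close>: otherwise \<open>\<beta>\<close> would double over steps of summable length.
\<close>

lemma mulholland_doubling_point:
  assumes \<beta>: "mulholland \<beta>"
  shows "\<exists>r\<ge>T. 0 < r \<and> \<beta> (r + 1 / \<beta> r) \<le> 2 * \<beta> r"
proof (rule ccontr)
  assume "\<not> ?thesis"
  then have neg: "2 * \<beta> r < \<beta> (r + 1 / \<beta> r)" if "T \<le> r" "0 < r" for r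
    using that by (meson linorder_not_less)
  define \<rho> where "\<rho> j = nonneg_inv \<beta> (2 ^ j)" for j :: nat
  have \<rho>: "0 \<le> \<rho> j" "\<beta> (\<rho> j) = 2 ^ j" for j
    using mulholland_nonneg_inv[OF \<beta>, of "2 ^ j"] by (auto simp: \<rho>_def)
  have pos: "0 < \<rho> j" for j
  proof (rule ccontr)
    assume "\<not> 0 < \<rho> j"
    then have "\<rho> j = 0" using \<rho>(1)[of j] by simp
    then show False using \<rho>(2)[of j] mulholland_zero[OF \<beta>] by simp
  qed
  obtain J :: nat where J: "\<beta> (max 0 T) \<le> 2 ^ J"
    using real_arch_pow[of 2 "\<beta> (max 0 T)"] by (auto intro: less_imp_le)
  have large: "T \<le> \<rho> (J + i)" for i
  proof -
    have "(2::real) ^ J \<le> 2 ^ (J + i)" by (intro power_increasing) auto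
    with J have "\<beta> (max 0 T) \<le> \<beta> (\<rho> (J + i))" unfolding \<rho>(2) by (rule order_trans)
    then show ?thesis using mulholland_le_iff[OF \<beta>, of "max 0 T" "\<rho> (J + i)"] \<rho>(1) by simp
  qed
  have step: "\<rho> (Suc (J + i)) \<le> \<rho> (J + i) + (1/2) ^ i" for i
  proof -
    let ?r = "\<rho> (J + i)"
    have "\<beta> (\<rho> (Suc (J + i))) < \<beta> (?r + 1 / \<beta> ?r)"
      using neg[OF large pos, of i] by (simp add: \<rho>(2))
    then have "\<rho> (Suc (J + i)) < ?r + 1 / \<beta> ?r"
      using mulholland_less_iff[OF \<beta>, of "\<rho> (Suc (J + i))" "?r + 1 / \<beta> ?r"] \<rho> by simp
    also have "1 / \<beta> ?r \<le> (1/2) ^ i"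
      by (simp add: \<rho>(2) power_one_over power_add field_simps)
    finally show ?thesis by simp
  qed
  have "\<rho> (J + i) \<le> \<rho> J + 2 - 2 * (1/2) ^ i" for i
  proof (induction i)
    case (Suc i)
    then show ?case using step[of i] by simp
  qed simp
  then have "\<rho> (J + i) \<le> \<rho> J + 2" for i
    by (rule order_trans) simp
  then have bound: "2 ^ (J + i) \<le> \<beta> (\<rho> J + 2)" for i
    using mulholland_le_iff[OF \<beta>, of "\<rho> (J + i)" "\<rho> J + 2"] \<rho> by simp
  obtain i :: nat where "\<beta> (\<rho> J + 2) < 2 ^ i"
    using real_arch_pow[of 2] by auto
  also have "\<dots> \<le> 2 ^ (J + i)" by (intro power_increasing) auto
  finally show False using bound[of i] by simp
qed

lemma mulholland_separating_scale:
  assumes \<alpha>: "mulholland \<alpha>" and \<beta>: "mulholland \<beta>"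
    and lim: "((\<lambda>x. \<alpha> x / \<beta> x) \<longlongrightarrow> 0) at_top" and \<epsilon>: "0 < \<epsilon>"
  shows "\<exists>m R. 0 < m \<and> m < 1 \<and> m < \<epsilon> \<and> m < R \<and> K < R - m \<and> \<beta> (R - m) * m = 1 \<and> \<alpha> R * m < \<epsilon>"
proof -
  have "eventually (\<lambda>x. \<alpha> x / \<beta> x < \<epsilon> / 2) at_top"
    using order_tendstoD(2)[OF lim, of "\<epsilon> / 2"] \<epsilon> by simp
  moreover have "eventually (\<lambda>x. max 1 (1 / \<epsilon>) + 1 \<le> \<beta> x) at_top"
    using \<beta> unfolding mulholland_def filterlim_at_top by blast
  ultimately have "eventually (\<lambda>x. \<alpha> x / \<beta> x < \<epsilon> / 2 \<and> max 1 (1 / \<epsilon>) + 1 \<le> \<beta> x) at_top"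
    by (rule eventually_conj)
  then obtain N where N: "\<And>x. N \<le> x \<Longrightarrow> \<alpha> x / \<beta> x < \<epsilon> / 2 \<and> max 1 (1 / \<epsilon>) + 1 \<le> \<beta> x"
    unfolding eventually_at_top_linorder by blast
  obtain r where r: "max N (K + 1) \<le> r" "0 < r" "\<beta> (r + 1 / \<beta> r) \<le> 2 * \<beta> r"
    using mulholland_doubling_point[OF \<beta>, of "max N (K + 1)"] by blast
  define m where "m = 1 / \<beta> r"
  have big: "1 < \<beta> r" "1 / \<epsilon> < \<beta> r" using N[of r] r(1) by auto
  then have m: "0 < m" "m < 1" "m < \<epsilon>" "\<beta> r * m = 1"
    using \<epsilon> by (auto simp: m_def field_simps)
  have "0 < \<beta> (r + m)" using mulholland_pos[OF \<beta>] r m by simp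
  moreover have "\<alpha> (r + m) / \<beta> (r + m) < \<epsilon> / 2" using N[of "r + m"] r(1) m by simp
  ultimately have "\<alpha> (r + m) < \<epsilon> / 2 * \<beta> (r + m)" by (simp add: pos_divide_less_eq)
  also have "\<dots> \<le> \<epsilon> / 2 * (2 * \<beta> r)"
    using r(3) \<epsilon> by (intro mult_left_mono) (auto simp: m_def)
  finally have "\<alpha> (r + m) * m < (\<epsilon> * \<beta> r) * m" using m by (intro mult_strict_right_mono) auto
  also have "\<dots> = \<epsilon>" using m(4) by simp
  finally show ?thesis
    using m r by (intro exI[of _ m] exI[of _ "r + m"]) auto
qed

definition cut_cube :: "'a::euclidean_space \<Rightarrow> real \<Rightarrow> 'a set" where
  "cut_cube b m = box 0 (One - m *\<^sub>R b)"

definition far_slab :: "'a::euclidean_space \<Rightarrow> real \<Rightarrow> real \<Rightarrow> 'a set" where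
  "far_slab b m R = box ((1 - m + R) *\<^sub>R b) (One + R *\<^sub>R b)"

definition shifted_cube :: "'a::euclidean_space \<Rightarrow> real \<Rightarrow> real \<Rightarrow> 'a set" where
  "shifted_cube b m R = cut_cube b m \<union> far_slab b m R"

context
  fixes b :: "'a::euclidean_space" and m R :: real
  assumes b: "b \<in> Basis" and m: "0 < m" "m < 1" "m < R"
begin

lemma mem_cut_cube: "x \<in> cut_cube b m \<longleftrightarrow> x \<in> box 0 One \<and> x \<bullet> b < 1 - m"
proof -
  have "x \<in> cut_cube b m \<longleftrightarrow> (\<forall>i\<in>Basis. 0 < x \<bullet> i \<and> x \<bullet> i < (if i = b then 1 - m else 1))"
    unfolding cut_cube_def mem_box using b
    by (intro ball_cong refl) (simp add: inner_diff_left inner_Basis)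
  also have "\<dots> \<longleftrightarrow> (\<forall>i\<in>Basis. 0 < x \<bullet> i \<and> x \<bullet> i < 1 \<and> (i = b \<longrightarrow> x \<bullet> b < 1 - m))"
    using m by (intro ball_cong refl) auto
  also have "\<dots> \<longleftrightarrow> x \<in> box 0 One \<and> x \<bullet> b < 1 - m"
    using b by (auto simp: mem_box)
  finally show ?thesis .
qed

lemma mem_far_slab: "x + R *\<^sub>R b \<in> far_slab b m R \<longleftrightarrow> x \<in> box 0 One \<and> 1 - m < x \<bullet> b"
proof -
  have "x + R *\<^sub>R b \<in> far_slab b m R \<longleftrightarrow>
      (\<forall>i\<in>Basis. (if i = b then 1 - m else 0) < x \<bullet> i \<and> x \<bullet> i < 1)"
    unfolding far_slab_def mem_box using b
    by (intro ball_cong refl) (simp add: inner_add_left inner_Basis)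
  also have "\<dots> \<longleftrightarrow> (\<forall>i\<in>Basis. 0 < x \<bullet> i \<and> x \<bullet> i < 1 \<and> (i = b \<longrightarrow> 1 - m < x \<bullet> b))"
    using m by (intro ball_cong refl) auto
  also have "\<dots> \<longleftrightarrow> x \<in> box 0 One \<and> 1 - m < x \<bullet> b"
    using b by (auto simp: mem_box)
  finally show ?thesis .
qed

lemma far_slab_inner: "x \<in> far_slab b m R \<Longrightarrow> 1 - m + R < x \<bullet> b"
  unfolding far_slab_def mem_box using b by (auto simp: inner_Basis)

lemma prod_Basis_single: "(\<Prod>i\<in>Basis. if i = b then t else 1) = (t::real)"
  using b by (subst prod.delta) auto

lemma measure_cut_cube: "measure lborel (cut_cube b m) = 1 - m"
proof -
  have "measure lborel (cut_cube b m) = (\<Prod>i\<in>Basis. (One - m *\<^sub>R b - 0) \<bullet> i)"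
    unfolding cut_cube_def using b m
    by (subst measure_lborel_box_eq) (auto simp: inner_diff_left inner_Basis)
  also have "\<dots> = (\<Prod>i\<in>Basis. if i = b then 1 - m else 1)"
    using b by (intro prod.cong) (auto simp: inner_diff_left inner_Basis)
  finally show ?thesis by (simp add: prod_Basis_single)
qed

lemma measure_far_slab: "measure lborel (far_slab b m R) = m"
proof -
  have "measure lborel (far_slab b m R) = (\<Prod>i\<in>Basis. (One + R *\<^sub>R b - (1 - m + R) *\<^sub>R b) \<bullet> i)"
    unfolding far_slab_def using b m
    by (subst measure_lborel_box_eq) (auto simp: inner_diff_left inner_add_left inner_Basis)
  also have "\<dots> = (\<Prod>i\<in>Basis. if i = b then m else 1)"
    using b by (intro prod.cong) (auto simp: inner_diff_left inner_add_left inner_Basis)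
  finally show ?thesis by (simp add: prod_Basis_single)
qed

lemma cut_far_nonempty: "cut_cube b m \<noteq> {}" "far_slab b m R \<noteq> {}"
  using measure_cut_cube measure_far_slab m by auto

lemma cut_far_disjoint: "cut_cube b m \<inter> far_slab b m R = {}"
  using far_slab_inner mem_cut_cube m by fastforce

lemma shifted_cube_pair: "shifted_cube b m R \<in> separated_convex_pairs"
proof -
  have cl: "closure (cut_cube b m) = cbox 0 (One - m *\<^sub>R b)"
    "closure (far_slab b m R) = cbox ((1 - m + R) *\<^sub>R b) (One + R *\<^sub>R b)"
    using cut_far_nonempty closure_box unfolding cut_cube_def far_slab_def by blast+
  have "x \<bullet> b \<le> 1 - m" if "x \<in> closure (cut_cube b m)" for x
    using that b unfolding cl mem_box by (auto simp: inner_diff_left inner_Basis dest!: bspec[of _ _ b])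
  moreover have "1 - m + R \<le> x \<bullet> b" if "x \<in> closure (far_slab b m R)" for x
    using that b unfolding cl mem_box by (auto simp: inner_Basis dest!: bspec[of _ _ b])
  ultimately have "closure (cut_cube b m) \<inter> closure (far_slab b m R) = {}" using m by fastforce
  moreover have "compact (closure (cut_cube b m))" unfolding cl by (rule compact_cbox)
  ultimately have "0 < setdist (closure (cut_cube b m)) (closure (far_slab b m R))"
    using cut_far_nonempty by (subst setdist_gt_0_compact_closed) auto
  moreover have "cut_cube b m \<in> convex_regions" "far_slab b m R \<in> convex_regions"
    using cut_far_nonempty unfolding cut_cube_def far_slab_def by (auto intro: box_convex_region)
  ultimately show ?thesis
    unfolding separated_convex_pairs_def shifted_cube_def by blast
qed

lemma shifted_cube_region: "shifted_cube b m R \<in> regions"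
  using shifted_cube_pair convex_or_pair_subset_regions by (auto simp: convex_or_pair_regions_def)

lemma measure_shifted_cube: "measure lborel (shifted_cube b m R) = 1"
proof -
  have "measure lborel (cut_cube b m \<union> far_slab b m R) = measure lborel (cut_cube b m) + measure lborel (far_slab b m R)"
    using cut_far_disjoint
    by (intro measure_Union) (auto simp: cut_cube_def far_slab_def emeasure_lborel_box_eq)
  then show ?thesis by (simp add: shifted_cube_def measure_cut_cube measure_far_slab)
qed

lemma unit_cube: "box (0::'a) One \<in> regions" "measure lborel (box (0::'a) One) = 1"
proof -
  show "measure lborel (box (0::'a) One) = 1" by (simp add: measure_lborel_box_eq)
  then have "box (0::'a) One \<noteq> {}" by force
  then show "box (0::'a) One \<in> regions" by (rule box_region)
qed

definition slab_shift :: "'a \<Rightarrow> 'a" where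
  "slab_shift x = (if x \<bullet> b < 1 - m then x else x + R *\<^sub>R b)"

lemma slab_shift_transport: "slab_shift \<in> transport_maps (box 0 One) (shifted_cube b m R)"
proof -
  have [measurable]: "slab_shift \<in> borel_measurable borel"
    unfolding slab_shift_def by measurable
  have [measurable]: "cut_cube b m \<in> sets borel" "far_slab b m R \<in> sets borel"
    by (auto simp: cut_cube_def far_slab_def)
  let ?P = "box (0::'a) One"
  let ?Q = "shifted_cube b m R"
  have [measurable]: "?Q \<in> sets borel" by (simp add: shifted_cube_def)
  have emP: "emeasure lborel ?P = 1"
    using unit_cube region_emeasure(2)[OF unit_cube(1)] by (simp add: emeasure_eq_ennreal_measure)
  have emQ: "emeasure lborel ?Q = 1"
    using measure_shifted_cube region_emeasure(2)[OF shifted_cube_region] by (simp add: emeasure_eq_ennreal_measure)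
  have "distr (uniform_measure lborel ?P) borel slab_shift = uniform_measure lborel ?Q"
  proof (rule measure_eqI)
    fix S assume "S \<in> sets (distr (uniform_measure lborel ?P) borel slab_shift)"
    then have S[measurable]: "S \<in> sets borel" by simp
    have vS[measurable]: "slab_shift -` S \<in> sets borel"
      using measurable_sets[of slab_shift borel borel S] by simp
    let ?F = "{x. x + R *\<^sub>R b \<in> far_slab b m R \<inter> S}"
    have [measurable]: "?F \<in> sets borel" by measurable
    have "emeasure lborel (?P \<inter> slab_shift -` S) = emeasure lborel ((cut_cube b m \<inter> S) \<union> ?F)"
    proof (rule emeasure_eq_AE)
      have "{x::'a. x \<bullet> b = 1 - m} \<in> null_sets lborel"
        using negligible_standard_hyperplane[OF b, of "1 - m"]
        by (subst null_sets_completion_iff[symmetric]) (auto simp: negligible_iff_null_sets)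
      from AE_not_in[OF this]
      show "AE x in lborel. x \<in> ?P \<inter> slab_shift -` S \<longleftrightarrow> x \<in> (cut_cube b m \<inter> S) \<union> ?F"
        by eventually_elim (auto simp: mem_cut_cube mem_far_slab slab_shift_def)
    qed auto
    also have "\<dots> = emeasure lborel (cut_cube b m \<inter> S) + emeasure lborel ?F"
      by (intro plus_emeasure[symmetric]) (auto simp: mem_cut_cube mem_far_slab)
    also have "emeasure lborel ?F = emeasure lborel (far_slab b m R \<inter> S)"
      by (rule emeasure_lborel_translate) measurable
    also have "emeasure lborel (cut_cube b m \<inter> S) + emeasure lborel (far_slab b m R \<inter> S) =
        emeasure lborel ((cut_cube b m \<inter> S) \<union> (far_slab b m R \<inter> S))"
      using cut_far_disjoint by (intro plus_emeasure) auto
    also have "(cut_cube b m \<inter> S) \<union> (far_slab b m R \<inter> S) = ?Q \<inter> S"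
      by (auto simp: shifted_cube_def)
    finally show "emeasure (distr (uniform_measure lborel ?P) borel slab_shift) S = emeasure (uniform_measure lborel ?Q) S"
      using vS by (subst emeasure_distr) (auto simp: emP emQ)
  qed simp
  then show ?thesis by (simp add: transport_maps_def)
qed

lemma wasserstein_shifted_cube_le:
  assumes \<psi>: "mulholland \<psi>"
  shows "wasserstein \<psi> (box 0 One) (shifted_cube b m R) \<le> nonneg_inv \<psi> (\<psi> R * m)"
proof -
  let ?P = "box (0::'a) One"
  let ?Q = "shifted_cube b m R"
  let ?U = "uniform_measure lborel ?P"
  let ?T = "{x. slab_shift x \<in> far_slab b m R}"
  interpret prob_space ?U by (rule prob_space_uniform_region[OF unit_cube(1)])
  have [measurable]: "slab_shift \<in> borel_measurable borel" "far_slab b m R \<in> sets borel"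
    using slab_shift_transport by (auto simp: transport_maps_def far_slab_def)
  have T[measurable]: "?T \<in> sets borel" by measurable
  have "measure ?U ?T = measure lborel (?Q \<inter> far_slab b m R) / measure lborel ?Q"
    by (rule measure_transport[OF unit_cube(1) shifted_cube_region slab_shift_transport]) measurable
  moreover have "?Q \<inter> far_slab b m R = far_slab b m R" by (auto simp: shifted_cube_def)
  ultimately have T_m: "measure ?U ?T = m" by (simp add: measure_shifted_cube measure_far_slab)
  have "mean_cost \<psi> ?P slab_shift \<le> (\<integral>x. \<psi> R * indicator ?T x \<partial>?U)"
    unfolding mean_cost_def
  proof (rule integral_mono_AE)
    show "integrable ?U (\<lambda>x. \<psi> R * indicator ?T x)"
      using T by (intro integrable_mult_right integrable_real_indicator) (auto simp: emeasure_eq_measure)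
    show "AE x in ?U. \<psi> (dist x (slab_shift x)) \<le> \<psi> R * indicator ?T x"
      using transport_AE[OF unit_cube(1) shifted_cube_region slab_shift_transport]
    proof eventually_elim
      case (elim x)
      show ?case
      proof (cases "x \<bullet> b < 1 - m")
        case True
        then have "\<psi> (dist x (slab_shift x)) = 0" by (simp add: slab_shift_def mulholland_zero[OF \<psi>])
        moreover have "0 \<le> \<psi> R" using m by (intro mulholland_nonneg[OF \<psi>]) simp
        ultimately show ?thesis by (auto split: split_indicator)
      next
        case False
        then have sx: "slab_shift x = x + R *\<^sub>R b" by (simp add: slab_shift_def)
        then have "slab_shift x \<notin> cut_cube b m" using False b m by (simp add: mem_cut_cube inner_add_left)
        then have "x \<in> ?T" using elim by (auto simp: shifted_cube_def)
        moreover have "dist x (slab_shift x) = R" using b m by (simp add: sx dist_norm)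
        ultimately show ?thesis by simp
      qed
    qed
  qed (rule cost_integrable[OF \<psi> unit_cube(1) shifted_cube_region slab_shift_transport])
  also have "\<dots> = \<psi> R * m" using T T_m by simp
  finally have "nonneg_inv \<psi> (mean_cost \<psi> ?P slab_shift) \<le> nonneg_inv \<psi> (\<psi> R * m)"
    by (intro nonneg_inv_mono[OF \<psi>] mean_cost_nonneg[OF \<psi>])
  then show ?thesis
    using wasserstein_le[OF \<psi> unit_cube(1) slab_shift_transport] by simp
qed

lemma wasserstein_shifted_cube_ge:
  assumes \<psi>: "mulholland \<psi>"
  shows "nonneg_inv \<psi> (\<psi> (R - m) * m) \<le> wasserstein \<psi> (box 0 One) (shifted_cube b m R)"
proof -
  have "R - m \<le> dist x y" if x: "x \<in> box 0 One" and y: "y \<in> shifted_cube b m R \<inter> far_slab b m R" for x y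
  proof -
    have "x \<bullet> b < 1" using x b by (simp add: mem_box)
    moreover have "1 - m + R < y \<bullet> b" using y far_slab_inner by simp
    moreover have "\<bar>(y - x) \<bullet> b\<bar> \<le> norm (y - x)" using b by (rule Basis_le_norm)
    ultimately show ?thesis by (simp add: inner_diff_left dist_norm norm_minus_commute)
  qed
  moreover have "shifted_cube b m R \<inter> far_slab b m R = far_slab b m R" by (auto simp: shifted_cube_def)
  moreover have "far_slab b m R \<in> sets borel" by (simp add: far_slab_def)
  ultimately show ?thesis
    using wasserstein_ge_target[OF \<psi> unit_cube(1) shifted_cube_region
        transport_maps_nonempty[OF unit_cube(1) shifted_cube_region], of "R - m" "far_slab b m R"] m
    by (simp add: measure_shifted_cube measure_far_slab unit_cube)
qed

lemma wasserstein_shifted_cube_ge_source: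
  assumes \<psi>: "mulholland \<psi>" and P: "P \<in> regions" and r: "0 < r"
    and ball: "ball c (2 * r) \<subseteq> P" "ball c (2 * r) \<inter> box 0 One = {}" and far: "norm c + 2 * r < R - m"
  shows "nonneg_inv \<psi> (\<psi> r * (measure lborel (ball c r) / measure lborel P)) \<le> wasserstein \<psi> P (shifted_cube b m R)"
proof (rule wasserstein_ge_ball_source[OF \<psi> P shifted_cube_region r])
  show "ball c r \<subseteq> P" using ball(1) r subset_ball[of r "2 * r" c] by auto
  have "y \<notin> far_slab b m R" if "y \<in> ball c (2 * r)" for y
  proof
    assume "y \<in> far_slab b m R"
    then have "R - m < y \<bullet> b" using far_slab_inner by fastforce
    also have "y \<bullet> b \<le> norm y" using Basis_le_norm[OF b, of y] by simp
    also have "\<dots> \<le> norm c + dist c y" by (metis add.commute dist_commute dist_norm norm_triangle_sub)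
    finally show False using that far by simp
  qed
  then show "ball c (2 * r) \<inter> shifted_cube b m R = {}"
    using ball(2) by (auto simp: shifted_cube_def mem_cut_cube)
qed

lemma wasserstein_shifted_cube_ge_target:
  assumes \<psi>: "mulholland \<psi>" and P: "P \<in> regions" and r: "0 < r"
    and ball: "ball c (2 * r) \<subseteq> box 0 One" "ball c (2 * r) \<inter> P = {}" and "m \<le> r"
  shows "nonneg_inv \<psi> (\<psi> r * measure lborel (ball c r)) \<le> wasserstein \<psi> P (shifted_cube b m R)"
proof -
  have "ball c r \<subseteq> cut_cube b m"
  proof
    fix y assume y: "y \<in> ball c r"
    have "dist c (y + r *\<^sub>R b) \<le> dist c y + r"
      using dist_triangle[of c "y + r *\<^sub>R b" y] b r by (simp add: dist_norm)
    then have "y + r *\<^sub>R b \<in> ball c (2 * r)" using y by simp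
    then have "y + r *\<^sub>R b \<in> box 0 One" using ball(1) by blast
    then have "y \<bullet> b + r < 1" using b by (auto simp: mem_box inner_add_left dest!: bspec[of _ _ b])
    moreover have "y \<in> box 0 One" using ball(1) y r by auto
    ultimately show "y \<in> cut_cube b m" using \<open>m \<le> r\<close> by (simp add: mem_cut_cube)
  qed
  then have "ball c r \<subseteq> shifted_cube b m R" by (auto simp: shifted_cube_def)
  from wasserstein_ge_ball_target[OF \<psi> P shifted_cube_region r this ball(2)]
  show ?thesis by (simp add: measure_shifted_cube)
qed

lemma unit_cube_neq_shifted_cube: "box 0 One \<noteq> shifted_cube b m R"
proof
  assume "box 0 One = shifted_cube b m R"
  then obtain y where "y \<in> far_slab b m R" "y \<in> box 0 One"
    using cut_far_nonempty(2) by (auto simp: shifted_cube_def)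
  then show False using far_slab_inner[of y] b m by (auto simp: mem_box dest!: bspec[of _ _ b])
qed

end

lemma strictly_finer_wasserstein:
  fixes M :: "'a::euclidean_space set set"
  assumes \<alpha>: "mulholland \<alpha>" and \<beta>: "mulholland \<beta>" and lim: "((\<lambda>x. \<alpha> x / \<beta> x) \<longlongrightarrow> 0) at_top"
    and M: "M \<subseteq> regions" "convex_or_pair_regions \<subseteq> M"
  shows "strictly_finer (metric_topology M (wasserstein \<beta>)) (metric_topology M (wasserstein \<alpha>))"
proof -
  have sub: "openin (metric_topology M (wasserstein \<beta>)) U" if U: "openin (metric_topology M (wasserstein \<alpha>)) U" for U
    unfolding openin_metric_topology
  proof (intro conjI ballI)
    show "U \<subseteq> M" using U by (simp add: openin_metric_topology)
    fix P assume P: "P \<in> U"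
    then obtain r where r: "0 < r" "{Q \<in> M. wasserstein \<alpha> P Q < r} \<subseteq> U"
      using U unfolding openin_metric_topology by blast
    obtain s where "0 < s" "\<And>P Q :: 'a set. P \<in> regions \<Longrightarrow> Q \<in> regions \<Longrightarrow> wasserstein \<beta> P Q < s \<Longrightarrow> wasserstein \<alpha> P Q < r"
      using wasserstein_dominated[OF \<alpha> \<beta> lim r(1)] by blast
    then show "\<exists>s>0. {Q \<in> M. wasserstein \<beta> P Q < s} \<subseteq> U"
      using r(2) P M(1) \<open>U \<subseteq> M\<close> by (intro exI[of _ s]) blast
  qed
  obtain b :: 'a where b: "b \<in> Basis" using nonempty_Basis by blast
  let ?good = "\<lambda>k m R. 0 < m \<and> m < 1 \<and> m < 1 / real (Suc k) \<and> m < R \<and> real k < R - m \<and>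
    \<beta> (R - m) * m = 1 \<and> \<alpha> R * m < 1 / real (Suc k)"
  have "\<forall>k. \<exists>mR. ?good k (fst mR) (snd mR)"
    using mulholland_separating_scale[OF \<alpha> \<beta> lim, of "1 / real (Suc k)" "real k" for k] by force
  then obtain mR where mR: "\<And>k. ?good k (fst (mR k)) (snd (mR k))" by metis
  define m where "m k = fst (mR k)" for k
  define R where "R k = snd (mR k)" for k
  have mk: "0 < m k" "m k < 1" "m k < R k" and small: "m k < 1 / real (Suc k)"
    and large: "real k < R k - m k" and \<beta>1: "\<beta> (R k - m k) * m k = 1" and \<alpha>0: "\<alpha> (R k) * m k < 1 / real (Suc k)" for k
    using mR[of k] by (simp_all add: m_def R_def)
  define Q where "Q k = shifted_cube b (m k) (R k)" for k
  note Q_reg = shifted_cube_region[OF b mk, folded Q_def]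
  let ?P = "box (0::'a) One"
  have PM: "?P \<in> M"
    using M(2) box_convex_region[of "0::'a" One] unit_cube(1)[OF b mk] 
    by (auto simp: convex_or_pair_regions_def regions_def)
  have QM: "Q k \<in> M" for k
    using M(2) shifted_cube_pair[OF b mk, folded Q_def] by (auto simp: convex_or_pair_regions_def)
  define U where "U = M - range Q"
  have away: "\<exists>s>0. \<forall>k. s \<le> wasserstein \<beta> P' (Q k)" if P': "P' \<in> U" for P'
  proof -
    have reg: "P' \<in> regions" and ne: "\<And>k. P' \<noteq> Q k" using P' M(1) by (auto simp: U_def)
    have "\<exists>s>0. \<exists>K. \<forall>k\<ge>K. s \<le> wasserstein \<beta> P' (Q k)"
    proof (cases "P' = ?P")
      case True
      then show ?thesis
        using wasserstein_shifted_cube_ge[OF b mk \<beta>, folded Q_def] nonneg_inv_pos[OF \<beta>, of 1]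
        by (auto simp: \<beta>1)
    next
      case False
      then obtain c r where r: "0 < r" and "ball c (2 * r) \<subseteq> P' \<and> ball c (2 * r) \<inter> ?P = {} \<or>
                        ball c (2 * r) \<subseteq> ?P \<and> ball c (2 * r) \<inter> P' = {}"
        using distinct_regions_ball[OF reg unit_cube(1)[OF b mk]] by blast
      then consider "ball c (2 * r) \<subseteq> P'" "ball c (2 * r) \<inter> ?P = {}"
        | "ball c (2 * r) \<subseteq> ?P" "ball c (2 * r) \<inter> P' = {}" by blast
      then show ?thesis
      proof cases
        case 1
        obtain K where K: "norm c + 2 * r < real K" using reals_Archimedean2 by blast
        have "norm c + 2 * r < R k - m k" if "K \<le> k" for k
          using K that large[of k] by linarith
        then show ?thesis
          using wasserstein_shifted_cube_ge_source[OF b mk \<beta> reg r 1, folded Q_def]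
            nonneg_inv_ball_pos[OF \<beta> reg r, of c] by blast
      next
        case 2
        obtain K where K: "1 / real (Suc K) < r" using r nat_approx_posE by blast
        have "m k \<le> r" if "K \<le> k" for k
        proof -
          have "1 / real (Suc k) \<le> 1 / real (Suc K)" using that by (simp add: frac_le)
          then show ?thesis using small[of k] K by linarith
        qed
        then show ?thesis
          using wasserstein_shifted_cube_ge_target[OF b mk \<beta> reg r 2, folded Q_def]
            nonneg_inv_ball_pos[OF \<beta> unit_cube(1)[OF b mk] r, of c] unit_cube(2)[OF b mk]
          by auto
      qed
    qed
    then obtain s K where s: "0 < s" "\<And>k. K \<le> k \<Longrightarrow> s \<le> wasserstein \<beta> P' (Q k)" by blast
    define s' where "s' = Min (insert s ((\<lambda>k. wasserstein \<beta> P' (Q k)) ` {..<K}))"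
    have "0 < s'" using s(1) wasserstein_pos[OF \<beta> reg Q_reg ne] by (auto simp: s'_def)
    moreover have "s' \<le> wasserstein \<beta> P' (Q k)" for k
    proof (cases "k < K")
      case True
      then show ?thesis by (auto simp: s'_def intro: Min_le)
    next
      case False
      have "s' \<le> s" by (simp add: s'_def)
      then show ?thesis using s(2)[of k] False by simp
    qed
    ultimately show ?thesis by blast
  qed
  have "openin (metric_topology M (wasserstein \<beta>)) U"
    unfolding openin_metric_topology
  proof (intro conjI ballI)
    show "U \<subseteq> M" by (auto simp: U_def)
    fix P' assume "P' \<in> U"
    from away[OF this] obtain s where s: "0 < s" "\<And>k. s \<le> wasserstein \<beta> P' (Q k)" by blast
    have "{P \<in> M. wasserstein \<beta> P' P < s} \<subseteq> U"
      using s(2) by (auto simp: U_def linorder_not_less[symmetric])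
    with s(1) show "\<exists>s>0. {P \<in> M. wasserstein \<beta> P' P < s} \<subseteq> U" by blast
  qed
  moreover have "\<not> openin (metric_topology M (wasserstein \<alpha>)) U"
  proof
    assume "openin (metric_topology M (wasserstein \<alpha>)) U"
    moreover have "?P \<in> U"
      using PM unit_cube_neq_shifted_cube[OF b mk, folded Q_def] by (auto simp: U_def)
    ultimately obtain r where r: "0 < r" "{Q \<in> M. wasserstein \<alpha> ?P Q < r} \<subseteq> U"
      unfolding openin_metric_topology by blast
    obtain k where k: "1 / real (Suc k) < \<alpha> r"
      using nat_approx_posE[OF mulholland_pos[OF \<alpha> r(1)]] by blast
    have "0 \<le> \<alpha> (R k) * m k" using mulholland_nonneg[OF \<alpha>, of "R k"] mk[of k] by simp
    moreover have "\<alpha> (R k) * m k < \<alpha> r" using \<alpha>0[of k] k by simp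
    ultimately have "nonneg_inv \<alpha> (\<alpha> (R k) * m k) < r"
      using r(1) by (simp add: nonneg_inv_less_iff[OF \<alpha>])
    then have "wasserstein \<alpha> ?P (Q k) < r"
      using wasserstein_shifted_cube_le[OF b mk \<alpha>, of k, folded Q_def] by simp
    then show False using r(2) QM by (auto simp: U_def)
  qed
  ultimately show ?thesis
    using sub unfolding strictly_finer_def by blast
qed

theorem theorem12:
  fixes \<alpha> \<beta> :: "real \<Rightarrow> real"
  assumes "DIM('a::euclidean_space) \<ge> 2"
    and "mulholland \<alpha>"
    and "mulholland \<beta>"
    and "((\<lambda>x. \<alpha> x / \<beta> x) \<longlongrightarrow> 0) at_top"
  shows "strictly_finer
           (metric_topology (regions :: 'a set set) (wasserstein \<beta>))
           (metric_topology (regions :: 'a set set) (wasserstein \<alpha>)) \<and>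
         strictly_finer
           (metric_topology (convex_or_pair_regions :: 'a set set) (wasserstein \<beta>))
           (metric_topology (convex_or_pair_regions :: 'a set set) (wasserstein \<alpha>))"
  using assms(2-4) convex_or_pair_subset_regions by (intro conjI strictly_finer_wasserstein) auto

end
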